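(* We have $$A^{1234}(x,q)=1+I^{1234}(x,q)+\frac{x}{1-xq}\left(A^{123}(x,q)-1\right)+\frac{x}{1-xq}\left(I^{123}(x,q)-\frac{x}{1-xq}\right).$$ Also, $$I^{1234}(x)=E(x)-\frac{2x}{1-x}C(x)+\frac{x^3}{(1-x)^3}+\frac{x^2}{(1-x)^2}+\frac{2x}{1-x}-1.$$ Moreover, $I^{1234}_1=1$ and for $n\ge2$, $$I^{1234}_n=E_n-2\sum_{i=0}^{n-1}C_i+\frac12\left(n^2-n+4\right),$$ where $C_m=\frac1{m+1}\binom{2m}m$ is the $m$-th Catalan number, $C(x)=\sum_{m\ge0}C_mx^m=\frac{1-\sqrt{1-4x}}{2x}$, $E_m$ is the number of $1234$-avoiding permutations of $[m]$ ($E_0=1$) and $E(x)=\sum_{m\ge0}E_mx^m$.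
   Context: For a permutation $\pi=\pi_1\cdots\pi_n$ of $[n]$, let $i_\pi$ be the smallest index $i$ with $\{\pi_1,\dots,\pi_i\}=\{1,\dots,i\}$; $\pi$ is indecomposable if $i_\pi=n$ (the empty permutation is not indecomposable). A permutation $\pi$ avoids a pattern $\tau\in\mathfrak S_k$ if no subsequence $\pi_{j_1}\cdots\pi_{j_k}$ ($j_1<\cdots<j_k$) is order-isomorphic to $\tau$. A descent of $\pi$ is an index $i$ with $\pi_i>\pi_{i+1}$. For a pattern $\sigma$, $A^\sigma_{n,i}$ (resp. $I^\sigma_{n,i}$) is the number of $\sigma$-avoiding permutations (resp. $\sigma$-avoiding indecomposable permutations) of $[n]$ with $i$ descents; $A^\sigma(x,q)=1+\sum_{n\ge1}\sum_iA^\sigma_{n,i}x^nq^i$, $I^\sigma(x,q)=\sum_{n\ge1}\sum_iI^\sigma_{n,i}x^nq^i$, $I^\sigma(x)=I^\sigma(x,1)=\sum_{n\ge1}I^\sigma_nx^n$. *)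

theory Defs
  imports
    Complex_Main
    "HOL-Computational_Algebra.Formal_Power_Series"
    "HOL-Combinatorics.Multiset_Permutations"
    "HOL-Library.Sublist"
begin

text \<open>
  Permutations of \<open>[n]\<close> are in one-line notation: the elements of
  \<open>permutations_of_set {1..n}\<close>, lists in which every element of \<open>{1..n}\<close> occurs exactly once.
  List positions are counted from \<open>0\<close>, so \<open>\<pi>\<^sub>i\<close> is \<open>\<pi> ! (i - 1)\<close>.
\<close>

definition order_isomorphic :: "nat list \<Rightarrow> nat list \<Rightarrow> bool" where
  "order_isomorphic \<rho> \<tau> \<longleftrightarrow> length \<rho> = length \<tau> \<and>
     (\<forall>i<length \<tau>. \<forall>j<length \<tau>. \<rho> ! i < \<rho> ! j \<longleftrightarrow> \<tau> ! i < \<tau> ! j)"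

definition avoids :: "nat list \<Rightarrow> nat list \<Rightarrow> bool" where
  "avoids \<pi> \<tau> \<longleftrightarrow> \<not> (\<exists>\<rho>. subseq \<rho> \<pi> \<and> order_isomorphic \<rho> \<tau>)"

definition descents :: "nat list \<Rightarrow> nat set" where
  "descents \<pi> = {i. Suc i < length \<pi> \<and> \<pi> ! i > \<pi> ! Suc i}"

text \<open>The index \<open>i\<^sub>\<pi>\<close>; it ranges over \<open>i \<ge> 1\<close>, as \<open>i = 0\<close> would satisfy the condition trivially.\<close>

definition first_component_length :: "nat list \<Rightarrow> nat" where
  "first_component_length \<pi> =
     (LEAST i. 1 \<le> i \<and> i \<le> length \<pi> \<and> set (take i \<pi>) = {1..i})"

definition indecomposable :: "nat list \<Rightarrow> bool" where
  "indecomposable \<pi> \<longleftrightarrow> \<pi> \<noteq> [] \<and> first_component_length \<pi> = length \<pi>"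

definition avoiding_perms :: "nat list \<Rightarrow> nat \<Rightarrow> nat list set" where
  "avoiding_perms \<sigma> n = {\<pi> \<in> permutations_of_set {1..n}. avoids \<pi> \<sigma>}"

definition avoiding_indec_perms :: "nat list \<Rightarrow> nat \<Rightarrow> nat list set" where
  "avoiding_indec_perms \<sigma> n = {\<pi> \<in> avoiding_perms \<sigma> n. indecomposable \<pi>}"

definition A_coeff :: "nat list \<Rightarrow> nat \<Rightarrow> nat \<Rightarrow> nat" where
  "A_coeff \<sigma> n i = card {\<pi> \<in> avoiding_perms \<sigma> n. card (descents \<pi>) = i}"

definition I_coeff :: "nat list \<Rightarrow> nat \<Rightarrow> nat \<Rightarrow> nat" where
  "I_coeff \<sigma> n i = card {\<pi> \<in> avoiding_indec_perms \<sigma> n. card (descents \<pi>) = i}"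

text \<open>
  Bivariate series in \<open>x\<close> and \<open>q\<close> are power series in \<open>x\<close> (outer) whose coefficients are power
  series in \<open>q\<close> (inner): the coefficient of \<open>x\<^sup>n q\<^sup>i\<close> in \<open>F\<close> is \<open>fps_nth (fps_nth F n) i\<close>.
\<close>

definition var_x :: "real fps fps" where
  "var_x = fps_X"

definition var_q :: "real fps fps" where
  "var_q = fps_const fps_X"

definition A_series2 :: "nat list \<Rightarrow> real fps fps" where
  "A_series2 \<sigma> = 1 + Abs_fps (\<lambda>n. if n = 0 then 0 else Abs_fps (\<lambda>i. of_nat (A_coeff \<sigma> n i)))"

definition I_series2 :: "nat list \<Rightarrow> real fps fps" where
  "I_series2 \<sigma> = Abs_fps (\<lambda>n. if n = 0 then 0 else Abs_fps (\<lambda>i. of_nat (I_coeff \<sigma> n i)))"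

definition I_num :: "nat list \<Rightarrow> nat \<Rightarrow> nat" where
  "I_num \<sigma> n = card (avoiding_indec_perms \<sigma> n)"

definition I_series :: "nat list \<Rightarrow> real fps" where
  "I_series \<sigma> = Abs_fps (\<lambda>n. if n = 0 then 0 else of_nat (I_num \<sigma> n))"

definition E_num :: "nat \<Rightarrow> nat" where
  "E_num m = card (avoiding_perms [1, 2, 3, 4] m)"

definition E_series :: "real fps" where
  "E_series = Abs_fps (\<lambda>m. of_nat (E_num m))"

definition catalan :: "nat \<Rightarrow> real" where
  "catalan m = 1 / of_nat (m + 1) * of_nat ((2 * m) choose m)"

definition catalan_series :: "real fps" where
  "catalan_series = Abs_fps catalan"

text \<open>
  The coefficient ring \<open>real fps\<close> is not a field, but \<open>1 - x q\<close> has constant coefficient \<open>1\<close>, so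
  dividing by it in \<open>real fps fps\<close> is genuine division.
\<close>

lemma divide_one_minus_xq:
  "(1 - var_x * var_q) * (F / (1 - var_x * var_q)) = F"
proof -
  let ?g = "1 - var_x * var_q"
  have g0: "fps_nth ?g 0 = 1"
    by (simp add: var_x_def)
  then have sd: "subdegree ?g = 0"
    by (metis subdegree_eq_0_iff zero_neq_one)
  have "?g * inverse ?g = 1"
    unfolding fps_inverse_def[of ?g]
    by (rule fps_right_inverse) (simp only: g0 fps_inverse_one' inverse_1 mult_1)
  moreover have "F / ?g = F * inverse ?g"
    by (simp add: fps_divide_def sd)
  ultimately show ?thesis
    by (simp add: mult.left_commute)
qed

lemma finite_avoiding_indec_perms: "finite (avoiding_indec_perms \<sigma> n)"
  by (simp add: avoiding_indec_perms_def avoiding_perms_def)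

lemma card_descents_less:
  assumes "\<pi> \<in> avoiding_perms \<sigma> n" "n > 0"
  shows "card (descents \<pi>) < n"
proof -
  have len: "length \<pi> = n"
    using assms(1) by (auto simp: avoiding_perms_def dest: length_finite_permutations_of_set)
  have "descents \<pi> \<subseteq> {..<n - 1}"
    by (auto simp: descents_def len)
  then have "card (descents \<pi>) \<le> n - 1"
    using card_mono[of "{..<n - 1}"] by simp
  with assms(2) show ?thesis by simp
qed

text \<open>Hence each \<open>x\<close>-coefficient is a polynomial in \<open>q\<close>, and \<open>I\<^sup>\<sigma>(x)\<close> is \<open>I\<^sup>\<sigma>(x, 1)\<close>.\<close>

lemma I_series2_nth_eq_0:
  assumes "i \<ge> n"
  shows "fps_nth (fps_nth (I_series2 \<sigma>) n) i = 0"
proof (cases "n = 0")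
  case False
  have "{\<pi> \<in> avoiding_indec_perms \<sigma> n. card (descents \<pi>) = i} = {}"
    using card_descents_less[of _ \<sigma> n] False assms
    by (force simp: avoiding_indec_perms_def)
  then have "I_coeff \<sigma> n i = 0"
    by (simp only: I_coeff_def card.empty)
  then show ?thesis by (simp add: I_series2_def)
qed (simp add: I_series2_def)

lemma I_series_nth:
  "fps_nth (I_series \<sigma>) n = (\<Sum>i<n. fps_nth (fps_nth (I_series2 \<sigma>) n) i)"
proof (cases "n = 0")
  case False
  let ?S = "avoiding_indec_perms \<sigma> n"
  have "card (descents \<pi>) < n" if "\<pi> \<in> ?S" for \<pi>
    using card_descents_less[of \<pi> \<sigma> n] that False by (auto simp: avoiding_indec_perms_def)
  then have "?S = (\<Union>i<n. {\<pi> \<in> ?S. card (descents \<pi>) = i})"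
    by auto
  then have "card ?S = card (\<Union>i<n. {\<pi> \<in> ?S. card (descents \<pi>) = i})"
    by simp
  also have "\<dots> = (\<Sum>i<n. I_coeff \<sigma> n i)"
    unfolding I_coeff_def
    by (rule card_UN_disjoint) (auto simp: finite_avoiding_indec_perms)
  finally show ?thesis
    using False by (simp add: I_series_def I_num_def I_series2_def)
qed (simp add: I_series_def)

end

theory Submission
  imports Defs
begin

text \<open>
  Split a nonempty permutation as \<open>\<alpha> \<oplus> \<beta>\<close> with \<open>\<alpha>\<close> its first indecomposable component. The longest
  increasing subsequence of \<open>\<alpha> \<oplus> \<beta>\<close> is the sum of those of \<open>\<alpha>\<close> and \<open>\<beta>\<close>, so for \<open>\<beta> \<noteq> []\<close> the sum avoids
  1234 iff either \<open>\<alpha>\<close> is decreasing and \<open>\<beta>\<close> avoids 123, or \<open>\<alpha>\<close> avoids 123 without being decreasing and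
  \<open>\<beta>\<close> is decreasing. Descents add up under \<open>\<oplus>\<close>, and the decreasing permutations contribute
  \<open>D = x / (1 - x q)\<close>. This gives the first identity with \<open>q\<close> in an arbitrary commutative ring; at
  \<open>q = 1\<close>, eliminating the indecomposable 123-avoiders through \<open>C = 1 + I + D\<^sup>2\<close> gives the second.
  That 123-avoiders are counted by the Catalan numbers follows by inserting the maximum: those whose
  first \<open>j\<close> entries decrease are counted by a difference of two binomial coefficients.
\<close>

section \<open>Increasing subsequences in place of the patterns 123 and 1234\<close>

definition has_increasing :: "nat \<Rightarrow> nat list \<Rightarrow> bool" where
  "has_increasing k \<pi> \<longleftrightarrow> (\<exists>\<rho>. subseq \<rho> \<pi> \<and> length \<rho> = k \<and> sorted_wrt (<) \<rho>)"

text \<open>In \<open>[1..<Suc k]\<close> the entry at position i is i + 1, so pattern entries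
  compare as their positions do. An occurrence of the pattern is therefore a strictly increasing
  subsequence of length k.\<close>

lemma order_isomorphic_upt_iff:
  "order_isomorphic \<rho> [1..<Suc k] \<longleftrightarrow> length \<rho> = k \<and> sorted_wrt (<) \<rho>"
proof -
  have "(\<forall>i<k. \<forall>j<k. \<rho> ! i < \<rho> ! j \<longleftrightarrow> i < j) \<longleftrightarrow> (\<forall>i j. i < j \<longrightarrow> j < k \<longrightarrow> \<rho> ! i < \<rho> ! j)"
    (is "?l \<longleftrightarrow> ?r")
  proof
    assume r: ?r
    show ?l
    proof (intro allI impI)
      fix i j assume "i < k" "j < k"
      then show "\<rho> ! i < \<rho> ! j \<longleftrightarrow> i < j"
        using r[rule_format, of i j] r[rule_format, of j i] by (cases i j rule: linorder_cases) auto
    qed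
  next
    assume ?l
    then show ?r by (meson less_trans)
  qed
  then show ?thesis
    by (auto simp: order_isomorphic_def sorted_wrt_iff_nth_less nth_upt simp del: upt_Suc)
qed

lemma avoids_upt_iff: "avoids \<pi> [1..<Suc k] \<longleftrightarrow> \<not> has_increasing k \<pi>"
  unfolding avoids_def has_increasing_def order_isomorphic_upt_iff by blast

lemma avoids_123_iff: "avoids \<pi> [1, 2, 3] \<longleftrightarrow> \<not> has_increasing 3 \<pi>"
proof -
  have "[1, 2, 3] = [1..<Suc 3]" by (simp add: numeral_eq_Suc)
  then show ?thesis by (simp only: avoids_upt_iff)
qed

lemma avoids_1234_iff: "avoids \<pi> [1, 2, 3, 4] \<longleftrightarrow> \<not> has_increasing 4 \<pi>"
proof -
  have "[1, 2, 3, 4] = [1..<Suc 4]" by (simp add: numeral_eq_Suc)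
  then show ?thesis by (simp only: avoids_upt_iff)
qed

lemma has_increasing_0 [simp]: "has_increasing 0 \<pi>"
  by (auto simp: has_increasing_def)

lemma has_increasing_1_iff [simp]: "has_increasing (Suc 0) \<pi> \<longleftrightarrow> \<pi> \<noteq> []"
proof
  assume "\<pi> \<noteq> []"
  then have "subseq [hd \<pi>] \<pi>" by (simp add: subseq_singleton_left)
  then show "has_increasing (Suc 0) \<pi>" unfolding has_increasing_def by (intro exI[of _ "[hd \<pi>]"]) simp
qed (auto simp: has_increasing_def)

lemma has_increasing_subseq:
  assumes "has_increasing k \<pi>" "subseq \<pi> \<sigma>"
  shows "has_increasing k \<sigma>"
  using assms unfolding has_increasing_def by (blast intro: subseq_order.trans)

lemma has_increasing_le:
  assumes "has_increasing k \<pi>" "j \<le> k"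
  shows "has_increasing j \<pi>"
proof -
  obtain \<rho> where \<rho>: "subseq \<rho> \<pi>" "length \<rho> = k" "sorted_wrt (<) \<rho>"
    using assms(1) by (auto simp: has_increasing_def)
  have "subseq (take j \<rho>) \<rho>" by (simp add: prefix_imp_subseq take_is_prefix)
  then have "subseq (take j \<rho>) \<pi>" using \<rho>(1) by (rule subseq_order.trans)
  moreover have "length (take j \<rho>) = j" using \<rho>(2) assms(2) by simp
  moreover have "sorted_wrt (<) (take j \<rho>)" using \<rho>(3) by (rule sorted_wrt_take)
  ultimately show ?thesis unfolding has_increasing_def by blast
qed

lemma has_increasing_2_iff: "has_increasing 2 \<pi> \<longleftrightarrow> (\<exists>a b. subseq [a, b] \<pi> \<and> a < b)"
proof
  assume "has_increasing 2 \<pi>"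
  then obtain \<rho> where "subseq \<rho> \<pi>" "length \<rho> = 2" "sorted_wrt (<) \<rho>"
    by (auto simp: has_increasing_def)
  moreover from this obtain a b where "\<rho> = [a, b]"
    by (auto simp: length_Suc_conv numeral_2_eq_2)
  ultimately have "subseq [a, b] \<pi>" "a < b" by simp_all
  then show "\<exists>a b. subseq [a, b] \<pi> \<and> a < b" by blast
next
  assume "\<exists>a b. subseq [a, b] \<pi> \<and> a < b"
  then obtain a b where "subseq [a, b] \<pi>" "a < b" by blast
  then show "has_increasing 2 \<pi>" unfolding has_increasing_def by (intro exI[of _ "[a, b]"]) simp
qed

text \<open>Entries of a general list may repeat, so the lack of an ascending pair forces only weak
  decrease.\<close>

lemma not_has_increasing_2_iff: "\<not> has_increasing 2 \<pi> \<longleftrightarrow> sorted_wrt (\<ge>) \<pi>"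
proof (induction \<pi>)
  case Nil
  then show ?case by (simp add: has_increasing_2_iff)
next
  case (Cons x xs)
  have "has_increasing 2 (x # xs) \<longleftrightarrow> has_increasing 2 xs \<or> (\<exists>y\<in>set xs. x < y)"
  proof
    assume "has_increasing 2 (x # xs)"
    then obtain a b where "subseq [a, b] (x # xs)" "a < b" unfolding has_increasing_2_iff by blast
    then show "has_increasing 2 xs \<or> (\<exists>y\<in>set xs. x < y)"
      unfolding has_increasing_2_iff by (cases "a = x") (auto simp: subseq_singleton_left)
  next
    assume "has_increasing 2 xs \<or> (\<exists>y\<in>set xs. x < y)"
    then show "has_increasing 2 (x # xs)"
    proof
      assume "has_increasing 2 xs"
      then show ?thesis by (rule has_increasing_subseq) auto
    next
      assume "\<exists>y\<in>set xs. x < y"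
      then obtain y where "subseq [x, y] (x # xs)" "x < y" by (auto simp: subseq_singleton_left)
      then show ?thesis unfolding has_increasing_2_iff by blast
    qed
  qed
  then show ?case using Cons by (auto simp: not_less)
qed

text \<open>A subsequence of a concatenation splits into a part from each side. Conversely, any two
  increasing parts glue together, as every entry of \<open>xs\<close> lies below every entry of
  \<open>ys\<close>.\<close>

lemma has_increasing_append_iff:
  assumes "\<And>a b. a \<in> set xs \<Longrightarrow> b \<in> set ys \<Longrightarrow> a < b"
  shows "has_increasing k (xs @ ys) \<longleftrightarrow> (\<exists>i\<le>k. has_increasing i xs \<and> has_increasing (k - i) ys)"
proof
  assume "has_increasing k (xs @ ys)"
  then obtain \<rho>1 \<rho>2 where "subseq \<rho>1 xs" "subseq \<rho>2 ys" "length (\<rho>1 @ \<rho>2) = k"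
    "sorted_wrt (<) (\<rho>1 @ \<rho>2)"
    unfolding has_increasing_def by (elim exE conjE subseq_appendE) simp
  then show "\<exists>i\<le>k. has_increasing i xs \<and> has_increasing (k - i) ys"
    by (intro exI[of _ "length \<rho>1"]) (auto simp: has_increasing_def sorted_wrt_append)
next
  assume "\<exists>i\<le>k. has_increasing i xs \<and> has_increasing (k - i) ys"
  then obtain i \<rho>1 \<rho>2 where *: "i \<le> k" "subseq \<rho>1 xs" "length \<rho>1 = i" "sorted_wrt (<) \<rho>1"
    "subseq \<rho>2 ys" "length \<rho>2 = k - i" "sorted_wrt (<) \<rho>2"
    unfolding has_increasing_def by blast
  have "set \<rho>1 \<subseteq> set xs" "set \<rho>2 \<subseteq> set ys"
    using list_emb_set[OF *(2)] list_emb_set[OF *(5)] by auto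
  then have "sorted_wrt (<) (\<rho>1 @ \<rho>2)" using *(4,7) assms by (auto simp: sorted_wrt_append)
  moreover have "subseq (\<rho>1 @ \<rho>2) (xs @ ys)" using *(2,5) by (rule list_emb_append_mono)
  ultimately show "has_increasing k (xs @ ys)" using *(1,3,6) unfolding has_increasing_def
    by (intro exI[of _ "\<rho>1 @ \<rho>2"]) auto
qed

lemma has_increasing_map_iff:
  assumes "strict_mono f"
  shows "has_increasing k (map f \<pi>) \<longleftrightarrow> has_increasing k \<pi>"
proof
  assume "has_increasing k (map f \<pi>)"
  then obtain \<rho> where \<rho>: "subseq \<rho> (map f \<pi>)" "length \<rho> = k" "sorted_wrt (<) \<rho>"
    by (auto simp: has_increasing_def)
  \<comment> \<open>Selecting by a position set \<open>N\<close> yields a subsequence of \<pi> whose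
    image under f is \<rho>.\<close>
  then obtain N where "\<rho> = map f (nths \<pi> N)" by (auto simp: subseq_conv_nths nths_map)
  moreover have "subseq (nths \<pi> N) \<pi>" by (auto simp: subseq_conv_nths)
  ultimately show "has_increasing k \<pi>" using \<rho> assms unfolding has_increasing_def
    by (intro exI[of _ "nths \<pi> N"]) (auto simp: sorted_wrt_map strict_mono_less)
next
  assume "has_increasing k \<pi>"
  then obtain \<rho> where "subseq \<rho> \<pi>" "length \<rho> = k" "sorted_wrt (<) \<rho>"
    by (auto simp: has_increasing_def)
  then show "has_increasing k (map f \<pi>)" using assms unfolding has_increasing_def
    by (intro exI[of _ "map f \<rho>"]) (auto simp: sorted_wrt_map strict_mono_less subseq_map)
qed

text \<open>Nothing can follow the maximum \<open>m\<close> in an increasing sequence. One of length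
  \<open>Suc k\<close> that uses \<open>m\<close> thus ends in it, and its other k entries come from
  \<open>ys\<close>.\<close>

lemma has_increasing_insert_max_iff:
  assumes "\<And>a. a \<in> set ys \<union> set zs \<Longrightarrow> a < m"
  shows "has_increasing (Suc k) (ys @ m # zs) \<longleftrightarrow>
    has_increasing (Suc k) (ys @ zs) \<or> has_increasing k ys"
proof
  assume "has_increasing (Suc k) (ys @ m # zs)"
  then obtain \<rho>1 \<rho>2 where \<rho>: "subseq \<rho>1 ys" "subseq \<rho>2 (m # zs)" "length (\<rho>1 @ \<rho>2) = Suc k"
    "sorted_wrt (<) (\<rho>1 @ \<rho>2)"
    unfolding has_increasing_def by (elim exE conjE subseq_appendE) simp
  show "has_increasing (Suc k) (ys @ zs) \<or> has_increasing k ys"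
  proof (cases "subseq \<rho>2 zs")
    case True
    then have "subseq (\<rho>1 @ \<rho>2) (ys @ zs)" using \<rho>(1) by (rule list_emb_append_mono[rotated])
    then show ?thesis using \<rho>(3,4) unfolding has_increasing_def by blast
  next
    case False
    then obtain \<rho>3 where \<rho>3: "\<rho>2 = m # \<rho>3" "subseq \<rho>3 zs"
      using \<rho>(2) by (cases \<rho>2) (auto split: if_splits)
    have "\<rho>3 = []"
    proof (rule ccontr)
      assume "\<rho>3 \<noteq> []"
      then have h: "hd \<rho>3 \<in> set \<rho>3" by simp
      then have "hd \<rho>3 \<in> set zs" using list_emb_set[OF \<rho>3(2)] by auto
      moreover have "m < hd \<rho>3" using \<rho>(4) \<rho>3(1) h by (simp add: sorted_wrt_append)
      ultimately show False using assms[of "hd \<rho>3"] by simp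
    qed
    then have "length \<rho>1 = k" "sorted_wrt (<) \<rho>1"
      using \<rho>(3,4) \<rho>3(1) by (auto simp: sorted_wrt_append)
    then show ?thesis using \<rho>(1) unfolding has_increasing_def by blast
  qed
next
  assume "has_increasing (Suc k) (ys @ zs) \<or> has_increasing k ys"
  then show "has_increasing (Suc k) (ys @ m # zs)"
  proof
    assume "has_increasing (Suc k) (ys @ zs)"
    then show ?thesis by (rule has_increasing_subseq) (auto intro: list_emb_append_mono)
  next
    assume "has_increasing k ys"
    then obtain \<rho> where \<rho>: "subseq \<rho> ys" "length \<rho> = k" "sorted_wrt (<) \<rho>"
      by (auto simp: has_increasing_def)
    have "\<forall>a\<in>set \<rho>. a < m" using list_emb_set[OF \<rho>(1)] assms by auto
    moreover have "subseq (\<rho> @ [m]) (ys @ m # zs)"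
      using \<rho>(1) by (intro list_emb_append_mono) auto
    ultimately show ?thesis using \<rho>(2,3) unfolding has_increasing_def
      by (intro exI[of _ "\<rho> @ [m]"]) (auto simp: sorted_wrt_append)
  qed
qed

section \<open>123-avoiding permutations counted by inserting the maximum\<close>

definition av123_dec_prefix :: "nat \<Rightarrow> nat \<Rightarrow> nat list set" where
  "av123_dec_prefix n j =
     {\<pi> \<in> permutations_of_set {1..n}. \<not> has_increasing 3 \<pi> \<and> \<not> has_increasing 2 (take j \<pi>)}"

text \<open>
  The maximum \<open>Suc n\<close> can only be inserted at the front or behind a decreasing prefix.
  The index \<open>p = j - 1\<close>, which is not a legal insertion position for \<open>j > 1\<close>, encodes insertion at
  the front.
\<close>

lemma bij_betw_insert_max:
  assumes "1 \<le> j" "j \<le> Suc n"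
  shows "bij_betw (\<lambda>(p, \<pi>). let i = (if p = j - 1 then 0 else p) in take i \<pi> @ Suc n # drop i \<pi>)
    (SIGMA p:{j - 1..n}. av123_dec_prefix n p) (av123_dec_prefix (Suc n) j)"
proof -
  define i where "i = (\<lambda>p. if p = j - 1 then 0 else p)"
  define f where "f = (\<lambda>(p, \<pi>). take (i p) \<pi> @ Suc n # drop (i p) \<pi>)"
  let ?S = "SIGMA p:{j - 1..n}. av123_dec_prefix n p"
  have perm: "set \<pi> = {1..n}" "distinct \<pi>" "length \<pi> = n"
    if "\<pi> \<in> av123_dec_prefix n p" for p \<pi>
    using that by (auto simp: av123_dec_prefix_def permutations_of_setD
        dest: length_finite_permutations_of_set)
  have i: "i p \<le> n" if "p \<in> {j - 1..n}" for p using that by (auto simp: i_def)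
  have "inj_on f ?S"
  proof (rule inj_onI, clarify)
    fix p \<pi> p' \<pi>'
    assume p: "p \<in> {j - 1..n}" "\<pi> \<in> av123_dec_prefix n p"
      and p': "p' \<in> {j - 1..n}" "\<pi>' \<in> av123_dec_prefix n p'" and eq: "f (p, \<pi>) = f (p', \<pi>')"
    have "Suc n \<notin> set \<pi>" "Suc n \<notin> set \<pi>'" using perm(1)[OF p(2)] perm(1)[OF p'(2)] by auto
    \<comment> \<open>The value \<open>Suc n\<close> occurs once in the common image, so the parts
      before and after it are determined.\<close>
    then have *: "take (i p) \<pi> = take (i p') \<pi>'" "drop (i p) \<pi> = drop (i p') \<pi>'"
      using eq unfolding f_def
      by (auto simp: append_eq_append_conv2 Cons_eq_append_conv append_eq_Cons_conv
          dest: in_set_takeD in_set_dropD)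
        (metis append_Cons append_eq_Cons_conv in_set_conv_decomp in_set_takeD in_set_dropD)+
    then have "\<pi> = \<pi>'" by (metis append_take_drop_id)
    moreover have "i p = i p'"
      using arg_cong[OF *(1), of length] perm(3)[OF p(2)] perm(3)[OF p'(2)] i[OF p(1)] i[OF p'(1)]
      by simp
    \<comment> \<open>Only \<open>p = j - 1\<close> has \<open>i p = 0\<close>: every larger p is at
      least \<open>j \<ge> 1\<close> and is kept by i.\<close>
    then have "p = p'" using p(1) p'(1) by (auto simp: i_def split: if_splits)
    ultimately show "p = p' \<and> \<pi> = \<pi>'" by simp
  qed
  moreover have "f ` ?S \<subseteq> av123_dec_prefix (Suc n) j"
  proof clarify
    fix p \<pi> assume p: "p \<in> {j - 1..n}" and \<pi>: "\<pi> \<in> av123_dec_prefix n p"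
    have less: "a < Suc n" if "a \<in> set (take m \<pi>) \<union> set (drop m' \<pi>)" for a m m'
      using that perm(1)[OF \<pi>] by (auto dest!: in_set_takeD in_set_dropD)
    have "set (take (i p) \<pi>) \<union> set (drop (i p) \<pi>) = {1..n}"
      using perm(1)[OF \<pi>] by (metis append_take_drop_id set_append)
    moreover have "set (take (i p) \<pi>) \<inter> set (drop (i p) \<pi>) = {}"
      using perm(2)[OF \<pi>] by (simp add: set_take_disj_set_drop_if_distinct)
    moreover have "Suc n \<notin> set (take (i p) \<pi>)" "Suc n \<notin> set (drop (i p) \<pi>)"
      using less by blast+
    ultimately have "set (f (p, \<pi>)) = {1..Suc n}" "distinct (f (p, \<pi>))"
      using perm(2)[OF \<pi>] by (auto simp: f_def)
    \<comment> \<open>In front of the new maximum stands either nothing or the decreasing prefix of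
      length p, so the maximum completes no 123.\<close>
    moreover have "\<not> has_increasing 2 (take (i p) \<pi>)"
      using \<pi> by (auto simp: av123_dec_prefix_def i_def not_has_increasing_2_iff)
    then have "\<not> has_increasing 3 (f (p, \<pi>))"
      using has_increasing_insert_max_iff[of "take (i p) \<pi>" "drop (i p) \<pi>" "Suc n" 2] less \<pi>
      by (simp add: f_def av123_dec_prefix_def numeral_3_eq_3)
    moreover have "\<not> has_increasing 2 (take j (f (p, \<pi>)))"
    proof (cases "p = j - 1")
      case True
      \<comment> \<open>At the front the maximum takes one of the first j places and leaves
        \<open>j - 1 = p\<close> for the decreasing prefix.\<close>
      then have "take j (f (p, \<pi>)) = [] @ Suc n # take p \<pi>"
        using assms(1) by (cases j) (auto simp: f_def i_def)
      then show ?thesis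
        using has_increasing_insert_max_iff[of "[]" "take p \<pi>" "Suc n" 1] less[of _ p p] \<pi>
        by (simp add: av123_dec_prefix_def numeral_2_eq_2)
    next
      case False
      \<comment> \<open>Here the insertion happens behind at least j entries, so the first j entries
        stay unchanged.\<close>
      then have "i p = p" "j \<le> p" using p by (auto simp: i_def)
      then have "take j (f (p, \<pi>)) = take j (take p \<pi>)"
        using perm(3)[OF \<pi>] p by (simp add: f_def)
      then have "subseq (take j (f (p, \<pi>))) (take p \<pi>)"
        by (simp only: prefix_imp_subseq take_is_prefix)
      then show ?thesis using \<pi> has_increasing_subseq by (auto simp: av123_dec_prefix_def)
    qed
    ultimately show "f (p, \<pi>) \<in> av123_dec_prefix (Suc n) j"
      by (auto simp: av123_dec_prefix_def)
  qed
  moreover have "av123_dec_prefix (Suc n) j \<subseteq> f ` ?S"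
  proof
    fix \<sigma> assume \<sigma>: "\<sigma> \<in> av123_dec_prefix (Suc n) j"
    then have set: "set \<sigma> = {1..Suc n}" "distinct \<sigma>"
      and inc: "\<not> has_increasing 3 \<sigma>" "\<not> has_increasing 2 (take j \<sigma>)"
      by (auto simp: av123_dec_prefix_def permutations_of_setD)
    have "Suc n \<in> set \<sigma>" using set by simp
    then obtain ys zs where split: "\<sigma> = ys @ Suc n # zs" by (meson split_list)
    define p where "p = (if ys = [] then j - 1 else length ys)"
    have "set ys \<union> set zs = {1..Suc n} - {Suc n}" "distinct (ys @ zs)"
      using set unfolding split by auto
    moreover have "{1..Suc n} - {Suc n} = {1..n}" by auto
    ultimately have yz: "set (ys @ zs) = {1..n}" "distinct (ys @ zs)" by auto
    have len: "length ys + length zs = n" using distinct_card[OF yz(2)] yz(1) by simp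
    have less: "a < Suc n" if "a \<in> set ys \<union> set zs" for a
    proof -
      have "a \<in> {1..n}" using that unfolding yz(1)[symmetric] by simp
      then show ?thesis by simp
    qed
    have inc': "\<not> has_increasing 3 (ys @ zs)" "\<not> has_increasing 2 ys"
      using has_increasing_insert_max_iff[of ys zs "Suc n" 2] less inc(1)
      by (simp_all add: split numeral_3_eq_3)
    \<comment> \<open>If a nonempty \<open>ys\<close> were shorter than j, the first j entries would
      contain an entry of \<open>ys\<close> followed by the maximum, hence an ascending
      pair.\<close>
    have jle: "j \<le> length ys" if "ys \<noteq> []"
    proof (rule ccontr)
      assume "\<not> j \<le> length ys"
      then obtain j' where "j - length ys = Suc j'" by (cases "j - length ys") auto
      then have "take j \<sigma> = ys @ Suc n # take j' zs" using \<open>\<not> j \<le> length ys\<close> by (simp add: split)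
      then have "has_increasing 2 (take j \<sigma>)"
        using has_increasing_insert_max_iff[of ys "take j' zs" "Suc n" 1] less that
        by (auto simp: numeral_2_eq_2 dest: in_set_takeD)
      with inc(2) show False by simp
    qed
    have p: "p \<in> {j - 1..n}" "i p = length ys"
      using jle len assms by (auto simp: p_def i_def)
    have "\<not> has_increasing 2 (take p (ys @ zs))"
    proof (cases "ys = []")
      case True
      then have "take j \<sigma> = Suc n # take p zs" using assms(1) by (cases j) (auto simp: p_def split)
      then show ?thesis
        using inc(2) True has_increasing_subseq[of 2 "take p zs" "take j \<sigma>"] by auto
    qed (use inc' in \<open>simp add: p_def\<close>)
    then have "(p, ys @ zs) \<in> ?S"
      using p yz inc' by (auto simp: av123_dec_prefix_def)
    moreover have "f (p, ys @ zs) = \<sigma>" by (simp add: f_def p(2) split)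
    ultimately show "\<sigma> \<in> f ` ?S" by (metis imageI)
  qed
  ultimately have "bij_betw f ?S (av123_dec_prefix (Suc n) j)" by (auto simp: bij_betw_def)
  then show ?thesis by (simp add: f_def i_def Let_def)
qed

lemma finite_av123_dec_prefix: "finite (av123_dec_prefix n j)"
  by (simp add: av123_dec_prefix_def)

lemma card_av123_dec_prefix_Suc:
  assumes "1 \<le> j" "j \<le> Suc n"
  shows "card (av123_dec_prefix (Suc n) j) = (\<Sum>p = j - 1..n. card (av123_dec_prefix n p))"
  using bij_betw_same_card[OF bij_betw_insert_max[OF assms]]
  by (simp add: card_SigmaI finite_av123_dec_prefix)

text \<open>Hockey-stick identity. The upper indices may stop at n, because those below n contribute
  0 when \<open>n \<le> m\<close>.\<close>

lemma sum_choose_descending: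
  assumes "i \<le> n" "n \<le> m"
  shows "(\<Sum>p = i..n. (2 * n - p) choose m) = Suc (2 * n - i) choose Suc m"
  using assms(1)
proof (induction i rule: inc_induct)
  case base
  then show ?case using assms(2) by (simp add: mult_2)
next
  case (step i)
  have "{i..n} = insert i {Suc i..n}" "i \<notin> {Suc i..n}" using step by auto
  moreover have "2 * n - i = Suc (2 * n - Suc i)" using step by simp
  ultimately show ?case using step by simp
qed

text \<open>The cardinalities are ballot numbers, put in additive form to avoid subtraction on
  naturals. Tracking j closes the recursion, since a decreasing prefix is what admits the next
  maximum. The induction hypothesis is summed over prefix lengths, with the hockey-stick identity
  applied to both binomials.\<close>

lemma card_av123_dec_prefix:
  assumes "j \<le> n"
  shows "card (av123_dec_prefix n j) + ((2 * n - j) choose Suc n) = (2 * n - j) choose n"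
  using assms
proof (induction n arbitrary: j)
  case 0
  have "av123_dec_prefix 0 0 = {[]}"
    by (auto simp: av123_dec_prefix_def has_increasing_def)
  then show ?case using 0 by simp
next
  case (Suc n)
  have pos: "card (av123_dec_prefix (Suc n) j) + ((2 * Suc n - j) choose Suc (Suc n))
      = (2 * Suc n - j) choose Suc n" if j: "1 \<le> j" "j \<le> Suc n" for j
  proof -
    have e: "2 * Suc n - j = Suc (2 * n - (j - 1))" using j by simp
    have "(\<Sum>p = j - 1..n. card (av123_dec_prefix n p)) + (\<Sum>p = j - 1..n. (2 * n - p) choose Suc n)
      = (\<Sum>p = j - 1..n. (2 * n - p) choose n)"
      unfolding sum.distrib[symmetric] by (rule sum.cong) (use Suc.IH in auto)
    moreover have "j - 1 \<le> n" using j by simp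
    ultimately show ?thesis
      unfolding card_av123_dec_prefix_Suc[OF j] e by (simp add: sum_choose_descending)
  qed
  show ?case
  proof (cases "j = 0")
    case True
    \<comment> \<open>A prefix of length 1 is no restriction, so the case \<open>j = 0\<close>,
      which the recursion does not reach, coincides with \<open>j = 1\<close>.\<close>
    have "has_increasing 2 (take (Suc 0) \<pi>) = False" for \<pi>
      using not_has_increasing_2_iff[of "take (Suc 0) \<pi>"] by (cases \<pi>) auto
    then have "av123_dec_prefix (Suc n) 0 = av123_dec_prefix (Suc n) 1"
      by (auto simp: av123_dec_prefix_def has_increasing_def)
    \<comment> \<open>After Pascal's rule, this symmetry turns the formula for \<open>j = 1\<close>
      into the one for \<open>j = 0\<close>.\<close>
    moreover have "(2 * n + 1) choose n = (2 * n + 1) choose Suc n"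
      by (subst binomial_symmetric) auto
    ultimately show ?thesis using pos[of 1] True by simp
  qed (use pos Suc.prems in auto)
qed

section \<open>Catalan numbers and their generating function\<close>

lemma catalan_eq: "catalan n = real ((2 * n) choose n) - real ((2 * n) choose Suc n)"
proof -
  \<comment> \<open>Both products equal \<open>2 * n * ((2 * n - 1) choose n)\<close>. Dividing by n
    + 1 turns the difference of the binomials into 1 / (n + 1) times the central one.\<close>
  have "Suc n * ((2 * n) choose Suc n) = n * ((2 * n) choose n)"
    using binomial_absorb_comp[of "2 * n" n] binomial_absorption[of n "2 * n"]
    by (simp add: mult_2)
  then have "real (Suc n) * real ((2 * n) choose Suc n) = real n * real ((2 * n) choose n)"
    by (metis of_nat_mult)
  then show ?thesis by (simp add: catalan_def field_simps)
qed

lemma card_avoiding_perms_123: "real (card (avoiding_perms [1, 2, 3] n)) = catalan n"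
proof -
  have "\<not> has_increasing 2 []" by (simp add: not_has_increasing_2_iff)
  then have "avoiding_perms [1, 2, 3] n = av123_dec_prefix n 0"
    unfolding avoiding_perms_def av123_dec_prefix_def avoids_123_iff by simp
  then show ?thesis
    using arg_cong[OF card_av123_dec_prefix[of 0 n], of real] by (simp add: catalan_eq)
qed

text \<open>The right-hand side is minus half the coefficient of x^(n + 1) in the square root of 1 -
  4 x. Both sides start at 1 and grow by the same ratio (4 n + 2) / (n + 2).\<close>

lemma catalan_gbinomial: "catalan n = - ((1 / 2) gchoose Suc n) * (- 4) ^ Suc n / 2"
proof (induction n)
  case 0
  show ?case by (simp add: catalan_def)
next
  case (Suc n)
  define c c' where "c = real ((2 * n) choose n)" and "c' = real ((2 * Suc n) choose Suc n)"
  have "Suc n * ((2 * Suc n) choose Suc n) = (2 * n + 2) * ((2 * n + 1) choose n)"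
    using Suc_times_binomial_eq[of "2 * n + 1" n] by simp
  also have "(2 * n + 1) choose n = (2 * n + 1) choose Suc n"
    by (subst binomial_symmetric) auto
  also have "(2 * n + 2) * \<dots> = 2 * (Suc n * (Suc (2 * n) choose Suc n))"
    by (simp only: Suc_eq_plus1) simp
  also have "Suc n * (Suc (2 * n) choose Suc n) = Suc (2 * n) * ((2 * n) choose n)"
    using Suc_times_binomial_eq[of "2 * n" n] by simp
  finally have "Suc n * ((2 * Suc n) choose Suc n) = 2 * (2 * n + 1) * ((2 * n) choose n)" by simp
  from arg_cong[OF this, of real] have "real (Suc n) * c' = 2 * (2 * real n + 1) * c"
    unfolding c_def c'_def by (simp only: of_nat_mult of_nat_add of_nat_numeral of_nat_1)
  then have "c' = (4 * real n + 2) * (c / real (n + 1))" by (simp add: field_simps)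
  moreover have "catalan n = c / real (n + 1)" "catalan (Suc n) = c' / (real n + 2)"
    by (simp_all add: catalan_def c_def c'_def del: binomial_Suc_Suc)
  ultimately have A: "catalan (Suc n) = (4 * real n + 2) / (real n + 2) * catalan n" by simp
  have B: "((1 / 2) gchoose Suc (Suc n))
      = (- (2 * real n + 1) / 2) / (real n + 2) * ((1 / 2) gchoose Suc n)"
    using gbinomial_mult_1[of "1 / 2 :: real" "Suc n"] by (simp add: field_simps)
  show ?case unfolding A B Suc power_Suc[of _ "Suc n"] by (simp add: field_simps)
qed

lemma catalan_series_radical:
  "catalan_series = (1 - fps_radical (\<lambda>k. root k) 2 (1 - 4 * fps_X)) / (2 * fps_X)"
proof -
  let ?m = "fps_const (- 4) * fps_X :: real fps"
  \<comment> \<open>Newton's series for (1 + x)^(1/2), evaluated at -4 x. Its square is 1 - 4 x and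
    its constant term is 1, which identifies it as the radical.\<close>
  define G where "G = fps_binomial (1 / 2 :: real) oo ?m"
  have Gn: "fps_nth G n = ((1 / 2) gchoose n) * (- 4) ^ n" for n
    by (simp add: G_def fps_compose_linear)
  have "G ^ 2 = (1 + fps_X) oo ?m"
    using fps_binomial_power[of "1 / 2 :: real" 2]
    by (simp add: G_def fps_compose_power fps_binomial_1)
  also have "\<dots> = 1 - 4 * fps_X"
    by (simp add: fps_compose_add_distrib numeral_fps_const flip: fps_const_neg)
  finally have sq: "G ^ Suc 1 = 1 - 4 * fps_X" by (simp add: numeral_2_eq_2)
  have "G = fps_radical (\<lambda>k. root k) (Suc 1) (1 - 4 * fps_X)"
    by (rule iffD1[OF radical_unique sq]) (simp_all add: Gn)
  then have G: "fps_radical (\<lambda>k. root k) 2 (1 - 4 * fps_X) = G" by (simp add: numeral_2_eq_2)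
  \<comment> \<open>Multiplying by \<open>2 * fps_X\<close> first shifts the index and avoids
    dividing by a series with zero constant term.\<close>
  have "1 - G = catalan_series * (2 * fps_X)"
  proof (rule fps_ext)
    fix n
    have "catalan_series * (2 * fps_X) = fps_const 2 * (fps_X * catalan_series)"
      by (simp only: numeral_fps_const mult_ac)
    moreover have "fps_nth (1 - G) n = fps_nth (fps_const 2 * (fps_X * catalan_series)) n"
      by (cases n) (simp_all add: Gn catalan_series_def catalan_gbinomial)
    ultimately show "fps_nth (1 - G) n = fps_nth (catalan_series * (2 * fps_X)) n" by (simp only:)
  qed
  then show ?thesis by (simp add: G)
qed

section \<open>Direct sums and the first indecomposable component\<close>

definition is_perm :: "nat list \<Rightarrow> bool" where
  "is_perm \<pi> \<longleftrightarrow> \<pi> \<in> permutations_of_set {1..length \<pi>}"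

definition oplus :: "nat list \<Rightarrow> nat list \<Rightarrow> nat list" where
  "oplus \<alpha> \<beta> = \<alpha> @ map ((+) (length \<alpha>)) \<beta>"

lemma is_perm_iff: "is_perm \<pi> \<longleftrightarrow> set \<pi> = {1..length \<pi>} \<and> distinct \<pi>"
  by (auto simp: is_perm_def permutations_of_setD)

lemma permutations_of_set_iff: "\<pi> \<in> permutations_of_set {1..n} \<longleftrightarrow> is_perm \<pi> \<and> length \<pi> = n"
proof -
  have "length \<pi> = n" if "\<pi> \<in> permutations_of_set {1..n}"
    using length_finite_permutations_of_set[OF that] by simp
  then show ?thesis unfolding is_perm_def by blast
qed

lemma length_oplus [simp]: "length (oplus \<alpha> \<beta>) = length \<alpha> + length \<beta>"
  by (simp add: oplus_def)

text \<open>The values 1 to \<open>length \<alpha>\<close> are used up by \<alpha>, so the shifted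
  \<beta> must fill exactly the interval above. One direction builds sums, the other recognises the
  remainder of a cut permutation.\<close>

lemma is_perm_oplus_iff:
  assumes "is_perm \<alpha>"
  shows "is_perm (oplus \<alpha> \<beta>) \<longleftrightarrow> is_perm \<beta>"
proof -
  let ?k = "length \<alpha>"
  have \<alpha>: "set \<alpha> = {1..?k}" "distinct \<alpha>" using assms by (auto simp: is_perm_iff)
  have img: "(+) ?k ` {1..length \<beta>} = {Suc ?k..?k + length \<beta>}"
    by (simp add: image_add_atLeastAtMost)
  have un: "{1..?k + length \<beta>} = {1..?k} \<union> {Suc ?k..?k + length \<beta>}" by auto
  show ?thesis
  proof
    assume "is_perm \<beta>"
    then have \<beta>: "set \<beta> = {1..length \<beta>}" "distinct \<beta>" by (auto simp: is_perm_iff)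
    show "is_perm (oplus \<alpha> \<beta>)"
      unfolding is_perm_iff length_oplus un
      by (simp add: oplus_def \<alpha> \<beta> distinct_map img del: One_nat_def) auto
  next
    assume a: "is_perm (oplus \<alpha> \<beta>)"
    then have s: "{1..?k} \<union> (+) ?k ` set \<beta> = {1..?k} \<union> {Suc ?k..?k + length \<beta>}"
      and d: "distinct \<beta>" "{1..?k} \<inter> (+) ?k ` set \<beta> = {}"
      unfolding is_perm_iff length_oplus un by (simp_all add: oplus_def \<alpha> distinct_map)
    have "{1..?k} \<inter> {Suc ?k..?k + length \<beta>} = {}" by auto
    then have "(+) ?k ` set \<beta> = (+) ?k ` {1..length \<beta>}" unfolding img using s d(2) by blast
    then have "set \<beta> = {1..length \<beta>}" by (rule inj_image_eq_iff[THEN iffD1, rotated]) simp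
    then show "is_perm \<beta>" using d(1) by (simp add: is_perm_iff)
  qed
qed

lemma has_increasing_oplus_iff:
  assumes "is_perm \<alpha>" "is_perm \<beta>"
  shows "has_increasing k (oplus \<alpha> \<beta>) \<longleftrightarrow>
    (\<exists>i\<le>k. has_increasing i \<alpha> \<and> has_increasing (k - i) \<beta>)"
proof -
  have "a < b" if "a \<in> set \<alpha>" "b \<in> set (map ((+) (length \<alpha>)) \<beta>)" for a b
    using that assms by (auto simp: is_perm_iff)
  then have "has_increasing k (oplus \<alpha> \<beta>) \<longleftrightarrow>
    (\<exists>i\<le>k. has_increasing i \<alpha> \<and> has_increasing (k - i) (map ((+) (length \<alpha>)) \<beta>))"
    unfolding oplus_def by (rule has_increasing_append_iff)
  then show ?thesis by (simp add: has_increasing_map_iff strict_mono_def)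
qed

lemma finite_descents [simp]: "finite (descents \<pi>)"
  by (rule finite_subset[of _ "{..<length \<pi>}"]) (auto simp: descents_def)

text \<open>Descents of \<beta> move by \<open>length \<alpha>\<close>. The junction is no descent,
  because entries of \<alpha> are at most \<open>length \<alpha>\<close> and the shifted entries are
  not below it.\<close>

lemma card_descents_oplus:
  assumes "is_perm \<alpha>" "is_perm \<beta>"
  shows "card (descents (oplus \<alpha> \<beta>)) = card (descents \<alpha>) + card (descents \<beta>)"
proof -
  let ?k = "length \<alpha>"
  have \<alpha>: "\<alpha> ! i \<le> ?k" if "i < ?k" for i
    using that assms(1) nth_mem[of i \<alpha>] by (auto simp: is_perm_iff)
  have \<beta>: "?k \<le> map ((+) ?k) \<beta> ! i" if "i < length \<beta>" for i
    using that by simp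
  have "i \<in> descents (oplus \<alpha> \<beta>) \<longleftrightarrow> i \<in> descents \<alpha> \<union> (+) ?k ` descents \<beta>" for i
  proof (cases "?k \<le> i")
    case True
    then obtain m where m: "i = ?k + m" using le_Suc_ex by blast
    then have "i \<notin> descents \<alpha>" by (simp add: descents_def)
    then show ?thesis
      by (auto simp: m descents_def oplus_def nth_append)
  next
    case False
    then have "i \<notin> (+) ?k ` descents \<beta>" by auto
    moreover have "i \<in> descents (oplus \<alpha> \<beta>) \<longleftrightarrow> i \<in> descents \<alpha>"
    proof (cases "Suc i < ?k")
      case True
      then show ?thesis by (auto simp: descents_def oplus_def nth_append)
    next
      case False
      then have "Suc i = ?k" using \<open>\<not> ?k \<le> i\<close> by simp
      then show ?thesis using \<alpha>[of i] \<beta>[of 0]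
        by (simp add: descents_def oplus_def nth_append del: nth_map) linarith
    qed
    ultimately show ?thesis by simp
  qed
  then have "descents (oplus \<alpha> \<beta>) = descents \<alpha> \<union> (+) ?k ` descents \<beta>" by blast
  moreover have "descents \<alpha> \<inter> (+) ?k ` descents \<beta> = {}" by (auto simp: descents_def)
  ultimately show ?thesis by (simp add: card_Un_disjoint card_image)
qed

text \<open>For a nonempty permutation the full length always qualifies, so it is the least
  qualifying index exactly when no shorter prefix qualifies.\<close>

lemma indecomposable_iff:
  assumes "is_perm \<pi>"
  shows "indecomposable \<pi> \<longleftrightarrow>
    \<pi> \<noteq> [] \<and> (\<forall>i. 1 \<le> i \<longrightarrow> i < length \<pi> \<longrightarrow> set (take i \<pi>) \<noteq> {1..i})"
proof -
  let ?P = "\<lambda>i. 1 \<le> i \<and> i \<le> length \<pi> \<and> set (take i \<pi>) = {1..i}"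
  have P: "?P (length \<pi>)" if "\<pi> \<noteq> []" using that assms by (simp add: is_perm_iff Suc_le_eq)
  have "(LEAST i. ?P i) = length \<pi> \<longleftrightarrow> (\<forall>i<length \<pi>. \<not> ?P i)" if "\<pi> \<noteq> []"
  proof
    assume "(LEAST i. ?P i) = length \<pi>"
    then show "\<forall>i<length \<pi>. \<not> ?P i" using not_less_Least[of _ ?P] by simp
  next
    assume "\<forall>i<length \<pi>. \<not> ?P i"
    then show "(LEAST i. ?P i) = length \<pi>" using P[OF that] by (intro Least_equality) (auto simp only: not_less)
  qed
  then show ?thesis unfolding indecomposable_def first_component_length_def by auto
qed

lemma not_indecomposable_oplus:
  assumes "is_perm \<alpha>" "is_perm \<beta>" "\<alpha> \<noteq> []" "\<beta> \<noteq> []"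
  shows "\<not> indecomposable (oplus \<alpha> \<beta>)"
proof -
  have "is_perm (oplus \<alpha> \<beta>)" using assms is_perm_oplus_iff by blast
  moreover have "set (take (length \<alpha>) (oplus \<alpha> \<beta>)) = {1..length \<alpha>}"
    using assms(1) by (simp add: oplus_def is_perm_iff)
  ultimately show ?thesis using assms(3,4) by (auto simp: indecomposable_iff Suc_le_eq)
qed

text \<open>The cut is made at the least k below the length whose prefix has the values 1 to k;
  minimality makes that prefix indecomposable.\<close>

lemma decomposable_obtains:
  assumes "is_perm \<pi>" "\<not> indecomposable \<pi>" "\<pi> \<noteq> []"
  obtains \<alpha> \<beta> where "\<pi> = oplus \<alpha> \<beta>" "is_perm \<alpha>" "indecomposable \<alpha>" "is_perm \<beta>" "\<beta> \<noteq> []"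
proof -
  let ?P = "\<lambda>i. 1 \<le> i \<and> i < length \<pi> \<and> set (take i \<pi>) = {1..i}"
  define k where "k = (LEAST i. ?P i)"
  have "\<exists>i. ?P i" using assms by (auto simp: indecomposable_iff)
  then have k: "?P k" unfolding k_def by (rule LeastI_ex)
  have min: "\<not> ?P i" if "i < k" for i using that unfolding k_def by (rule not_less_Least)
  define \<alpha> where "\<alpha> = take k \<pi>"
  define \<beta> where "\<beta> = map (\<lambda>x. x - k) (drop k \<pi>)"
  have len: "length \<alpha> = k" using k by (simp add: \<alpha>_def)
  have set: "set \<pi> = {1..length \<pi>}" "distinct \<pi>" using assms(1) by (auto simp: is_perm_iff)
  have \<alpha>: "is_perm \<alpha>" using k set(2) len by (simp add: is_perm_iff \<alpha>_def)
  \<comment> \<open>The prefix uses the values up to k, so later entries exceed k and the truncated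
    subtraction in \<beta> loses nothing.\<close>
  have "k < x" if "x \<in> set (drop k \<pi>)" for x
  proof -
    have "x \<notin> {1..k}" using that k set_take_disj_set_drop_if_distinct[OF set(2), of k k] by auto
    moreover have "x \<in> {1..length \<pi>}" using that set(1) in_set_dropD by metis
    ultimately show ?thesis by auto
  qed
  then have "map ((+) k) \<beta> = drop k \<pi>" unfolding \<beta>_def map_map by (intro map_idI) fastforce
  then have \<pi>: "\<pi> = oplus \<alpha> \<beta>" by (simp add: oplus_def len) (simp add: \<alpha>_def)
  have "indecomposable \<alpha>"
    unfolding indecomposable_iff[OF \<alpha>] using k min len by (auto simp: \<alpha>_def)
  moreover have "is_perm \<beta>" using assms(1) \<alpha> \<pi> is_perm_oplus_iff by metis
  moreover have "\<beta> \<noteq> []" using k by (simp add: \<beta>_def)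
  ultimately show ?thesis using that \<pi> \<alpha> by blast
qed

text \<open>Were \<alpha> longer, \<alpha>' would be a proper nonempty prefix of it with the values
  1 to its length, against indecomposability. Applied in both directions, this makes the first
  component unique.\<close>

lemma oplus_eq_length_le:
  assumes "oplus \<alpha> \<beta> = oplus \<alpha>' \<beta>'" "is_perm \<alpha>" "is_perm \<alpha>'" "indecomposable \<alpha>" "\<alpha>' \<noteq> []"
  shows "length \<alpha> \<le> length \<alpha>'"
proof (rule ccontr)
  assume "\<not> length \<alpha> \<le> length \<alpha>'"
  moreover from this have "take (length \<alpha>') \<alpha> = \<alpha>'"
    using arg_cong[OF assms(1), of "take (length \<alpha>')"] by (simp add: oplus_def)
  then have "set (take (length \<alpha>') \<alpha>) = {1..length \<alpha>'}" using assms(3) by (simp add: is_perm_iff)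
  ultimately show False using assms(2,4,5) by (auto simp: indecomposable_iff Suc_le_eq)
qed

lemma inj_on_oplus:
  "inj_on (\<lambda>(\<alpha>, \<beta>). oplus \<alpha> \<beta>) ({\<alpha>. is_perm \<alpha> \<and> indecomposable \<alpha>} \<times> T)"
proof (rule inj_onI, clarify)
  fix \<alpha> \<beta> \<alpha>' \<beta>'
  assume *: "oplus \<alpha> \<beta> = oplus \<alpha>' \<beta>'" "is_perm \<alpha>" "indecomposable \<alpha>" "is_perm \<alpha>'" "indecomposable \<alpha>'"
  then have "length \<alpha> = length \<alpha>'"
    by (intro antisym oplus_eq_length_le[of _ \<beta> _ \<beta>'] oplus_eq_length_le[of _ \<beta>' _ \<beta>])
      (auto simp: indecomposable_def)
  with *(1) show "\<alpha> = \<alpha>' \<and> \<beta> = \<beta>'" by (simp add: oplus_def inj_map_eq_map)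
qed

section \<open>Generating functions by length and number of descents\<close>

definition descent_gf :: "'a::comm_ring_1 \<Rightarrow> nat list set \<Rightarrow> 'a fps" where
  "descent_gf q S = Abs_fps (\<lambda>n. \<Sum>\<pi> | \<pi> \<in> S \<and> length \<pi> = n. q ^ card (descents \<pi>))"

lemma finite_perms_length:
  assumes "S \<subseteq> Collect is_perm"
  shows "finite {\<pi> \<in> S. length \<pi> = n}"
  by (rule finite_subset[of _ "permutations_of_set {1..n}"])
    (use assms in \<open>auto simp: permutations_of_set_iff simp del: One_nat_def\<close>)

lemma descent_gf_Un:
  assumes "S \<subseteq> Collect is_perm" "T \<subseteq> Collect is_perm" "S \<inter> T = {}"
  shows "descent_gf q (S \<union> T) = descent_gf q S + descent_gf q T"
proof (rule fps_ext)
  fix n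
  have "{\<pi> \<in> S \<union> T. length \<pi> = n} = {\<pi> \<in> S. length \<pi> = n} \<union> {\<pi> \<in> T. length \<pi> = n}" by auto
  moreover have "{\<pi> \<in> S. length \<pi> = n} \<inter> {\<pi> \<in> T. length \<pi> = n} = {}" using assms(3) by auto
  ultimately show "fps_nth (descent_gf q (S \<union> T)) n = fps_nth (descent_gf q S + descent_gf q T) n"
    by (simp add: descent_gf_def sum.union_disjoint finite_perms_length assms(1,2))
qed

lemma descent_gf_Nil: "descent_gf q {[]} = 1"
proof (rule fps_ext)
  fix n
  have *: "{\<pi> \<in> {[]}. length \<pi> = n} = (if n = 0 then {[]} else {})" by auto
  show "fps_nth (descent_gf q {[]}) n = fps_nth 1 n"
    unfolding descent_gf_def fps_nth_Abs_fps * by (simp add: descents_def)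
qed

text \<open>Pairs are grouped by the length k of the first summand. Unique decomposition rules out
  double counting and descents add, so the sum becomes a Cauchy product.\<close>

lemma descent_gf_oplus:
  assumes "S \<subseteq> {\<alpha>. is_perm \<alpha> \<and> indecomposable \<alpha>}" "T \<subseteq> Collect is_perm"
  shows "descent_gf q ((\<lambda>(\<alpha>, \<beta>). oplus \<alpha> \<beta>) ` (S \<times> T)) = descent_gf q S * descent_gf q T"
proof (rule fps_ext)
  fix n
  define f where "f = (\<lambda>(\<alpha>, \<beta>). oplus \<alpha> \<beta>)"
  let ?w = "\<lambda>\<pi>. q ^ card (descents \<pi>)"
  let ?L = "\<lambda>S n. {\<pi> \<in> S. length \<pi> = n}"
  let ?R = "SIGMA k:{0..n}. ?L S k \<times> ?L T (n - k)"
  have S: "S \<subseteq> Collect is_perm" using assms(1) by auto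
  have inj: "inj_on f (S \<times> T)"
    unfolding f_def by (rule inj_on_subset[OF inj_on_oplus[of T]]) (use assms(1) in auto)
  have "inj_on (\<lambda>(k, p). f p) ?R"
    by (rule inj_onI) (auto dest!: inj_onD[OF inj])
  moreover have "(\<lambda>(k, p). f p) ` ?R = ?L (f ` (S \<times> T)) n"
  proof
    show "(\<lambda>(k, p). f p) ` ?R \<subseteq> ?L (f ` (S \<times> T)) n" by (auto simp: f_def)
    show "?L (f ` (S \<times> T)) n \<subseteq> (\<lambda>(k, p). f p) ` ?R"
    proof clarify
      fix \<alpha> \<beta> assume "\<alpha> \<in> S" "\<beta> \<in> T" "n = length (f (\<alpha>, \<beta>))"
      then have "(length \<alpha>, \<alpha>, \<beta>) \<in> (SIGMA k:{0..length (f (\<alpha>, \<beta>))}.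
          ?L S k \<times> ?L T (length (f (\<alpha>, \<beta>)) - k))" by (auto simp: f_def)
      then show "f (\<alpha>, \<beta>) \<in> (\<lambda>(k, p). f p) ` (SIGMA k:{0..length (f (\<alpha>, \<beta>))}.
          ?L S k \<times> ?L T (length (f (\<alpha>, \<beta>)) - k))" by (rule rev_image_eqI) simp
    qed
  qed
  ultimately have "fps_nth (descent_gf q (f ` (S \<times> T))) n = (\<Sum>(k, p)\<in>?R. ?w (f p))"
    unfolding descent_gf_def fps_nth_Abs_fps
    by (subst sum.reindex_cong[of "\<lambda>(k, p). f p" ?R]) (auto simp: case_prod_unfold)
  also have "\<dots> = (\<Sum>k = 0..n. \<Sum>p\<in>?L S k \<times> ?L T (n - k). ?w (f p))"
    by (rule sum.Sigma[symmetric]) (auto simp: finite_perms_length S assms(2))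
  also have "\<dots> = (\<Sum>k = 0..n. \<Sum>(\<alpha>, \<beta>)\<in>?L S k \<times> ?L T (n - k). ?w \<alpha> * ?w \<beta>)"
    using S assms(2)
    by (intro sum.cong refl) (auto simp: f_def card_descents_oplus power_add subset_iff)
  also have "\<dots> = fps_nth (descent_gf q S * descent_gf q T) n"
    by (simp add: fps_mult_nth descent_gf_def sum_product sum.cartesian_product)
  finally show "fps_nth (descent_gf q ((\<lambda>(\<alpha>, \<beta>). oplus \<alpha> \<beta>) ` (S \<times> T))) n
      = fps_nth (descent_gf q S * descent_gf q T) n"
    by (simp add: f_def)
qed

section \<open>Decomposition of the 123-avoiders and the 1234-avoiders\<close>

definition Av :: "nat list \<Rightarrow> nat list set" where
  "Av \<sigma> = {\<pi>. is_perm \<pi> \<and> avoids \<pi> \<sigma>}"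

definition Ind :: "nat list \<Rightarrow> nat list set" where
  "Ind \<sigma> = {\<pi> \<in> Av \<sigma>. indecomposable \<pi>}"

text \<open>The empty permutation is left out so that all members are indecomposable and the series
  is exactly x / (1 - x q).\<close>

definition Dec :: "nat list set" where
  "Dec = {\<pi>. is_perm \<pi> \<and> \<pi> \<noteq> [] \<and> \<not> has_increasing 2 \<pi>}"

text \<open>The reversed list is sorted and distinct with the values 1 to its length, and only one
  list is such. The empty permutation is the case \<open>n = 0\<close>.\<close>

lemma is_perm_decreasing_iff:
  "is_perm \<pi> \<and> \<not> has_increasing 2 \<pi> \<longleftrightarrow> (\<exists>n. \<pi> = rev [1..<Suc n])"
proof
  assume *: "is_perm \<pi> \<and> \<not> has_increasing 2 \<pi>"
  have "sorted (rev \<pi>)" using * by (simp add: not_has_increasing_2_iff sorted_wrt_rev)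
  moreover have "distinct (rev \<pi>)" using * by (simp add: is_perm_iff)
  moreover have "set (rev \<pi>) = set [1..<Suc (length \<pi>)]"
    using * unfolding set_upt set_rev atLeastLessThanSuc_atLeastAtMost is_perm_iff by blast
  ultimately have "rev \<pi> = [1..<Suc (length \<pi>)]"
    by (rule sorted_distinct_set_unique[OF _ _ sorted_upt distinct_upt])
  then have "\<pi> = rev [1..<Suc (length \<pi>)]" by (simp only: rev_swap)
  then show "\<exists>n. \<pi> = rev [1..<Suc n]" by blast
next
  have "is_perm (rev [1..<Suc n])" for n
    by (simp add: is_perm_iff atLeastLessThanSuc_atLeastAtMost del: upt_Suc)
  moreover have "sorted_wrt (\<ge>) (rev [1..<Suc n])" for n
    by (simp add: sorted_wrt_rev del: upt_Suc)
  moreover assume "\<exists>n. \<pi> = rev [1..<Suc n]"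
  ultimately show "is_perm \<pi> \<and> \<not> has_increasing 2 \<pi>"
    unfolding not_has_increasing_2_iff by blast
qed

text \<open>The maximum comes first, so every nonempty prefix contains it and no proper one has the
  values 1 to i.\<close>

lemma indecomposable_Dec:
  assumes "\<pi> \<in> Dec"
  shows "indecomposable \<pi>"
proof -
  have \<pi>: "is_perm \<pi>" "\<pi> \<noteq> []" using assms by (auto simp: Dec_def)
  obtain n where n: "\<pi> = rev [1..<Suc n]"
    using assms is_perm_decreasing_iff[of \<pi>] unfolding Dec_def by blast
  have max: "length \<pi> \<in> set (take i \<pi>)" if "1 \<le> i" for i
  proof -
    have "hd \<pi> = length \<pi>" using \<pi>(2) by (cases n) (simp_all add: n)
    moreover have "hd \<pi> \<in> set (take i \<pi>)" using \<pi>(2) that by (cases \<pi>; cases i) auto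
    ultimately show ?thesis by simp
  qed
  have "set (take i \<pi>) \<noteq> {1..i}" if "1 \<le> i" "i < length \<pi>" for i
  proof
    assume "set (take i \<pi>) = {1..i}"
    then have "length \<pi> \<in> {1..i}" using max[OF that(1)] by blast
    then show False using that(2) by simp
  qed
  then show ?thesis using \<pi>(1,2) by (simp add: indecomposable_iff)
qed

text \<open>There is one member of each length n + 1, with n descents. The quotient x / (1 - x q) is
  multiplied out because q lives in an arbitrary commutative ring.\<close>

lemma descent_gf_Dec: "(1 - fps_X * fps_const q) * descent_gf q Dec = fps_X"
proof -
  have nth: "fps_nth (descent_gf q Dec) (Suc n) = q ^ n" for n
  proof -
    have "{\<pi> \<in> Dec. length \<pi> = Suc n} = {rev [1..<Suc (Suc n)]}" (is "?L = {?r}")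
    proof -
      have "is_perm ?r \<and> \<not> has_increasing 2 ?r" unfolding is_perm_decreasing_iff by blast
      then have "?r \<in> Dec" by (simp add: Dec_def)
      moreover have "\<pi> = ?r" if \<pi>: "\<pi> \<in> Dec" "length \<pi> = Suc n" for \<pi>
      proof -
        obtain m where m: "\<pi> = rev [1..<Suc m]"
          using \<pi>(1) is_perm_decreasing_iff[of \<pi>] unfolding Dec_def by blast
        moreover have "m = Suc n" using \<pi>(2) unfolding m by (simp del: upt_Suc)
        ultimately show ?thesis by (simp only:)
      qed
      moreover have "length ?r = Suc n" by (simp del: upt_Suc)
      ultimately show ?thesis by blast
    qed
    moreover have "descents ?r = {..<n}"
      by (auto simp: descents_def rev_nth nth_upt simp del: upt_Suc)
    ultimately show ?thesis by (simp add: descent_gf_def del: upt_Suc)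
  qed
  have 0: "fps_nth (descent_gf q Dec) 0 = 0"
  proof -
    have *: "{\<pi> \<in> Dec. length \<pi> = 0} = {}" by (auto simp: Dec_def)
    show ?thesis unfolding descent_gf_def fps_nth_Abs_fps * by simp
  qed
  show ?thesis
  proof (rule fps_ext)
    fix n
    have *: "(1 - fps_X * fps_const q) * descent_gf q Dec
        = descent_gf q Dec - fps_const q * (fps_X * descent_gf q Dec)" by (simp add: algebra_simps)
    show "fps_nth ((1 - fps_X * fps_const q) * descent_gf q Dec) n = fps_nth fps_X n"
    proof (cases n)
      case (Suc m)
      \<comment> \<open>Degree 1 keeps the coefficient 1; from degree 2 on,
        \<open>q ^ m - q * q ^ (m - 1)\<close> cancels.\<close>
      then show ?thesis using nth 0 * by (cases m) simp_all
    qed (use 0 * in simp)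
  qed
qed

lemma Av_decompose:
  assumes "avoids [] \<sigma>"
  shows "Av \<sigma> = {[]} \<union> Ind \<sigma> \<union>
    {\<pi>. \<exists>\<alpha> \<beta>. \<pi> = oplus \<alpha> \<beta> \<and> is_perm \<alpha> \<and> indecomposable \<alpha> \<and> is_perm \<beta> \<and> \<beta> \<noteq> [] \<and> avoids \<pi> \<sigma>}"
    (is "_ = _ \<union> ?R")
proof
  show "Av \<sigma> \<subseteq> {[]} \<union> Ind \<sigma> \<union> ?R"
    by (auto simp: Av_def Ind_def elim: decomposable_obtains)
  show "{[]} \<union> Ind \<sigma> \<union> ?R \<subseteq> Av \<sigma>"
    using assms is_perm_oplus_iff by (auto simp: Av_def Ind_def is_perm_iff[of "[]"])
qed

text \<open>A nonempty summand always supplies one entry, so the splits 1 + 2 and 2 + 1 decide; 0 +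
  3 and 3 + 0 imply them.\<close>

lemma has_increasing_3_oplus_iff:
  assumes "is_perm \<alpha>" "is_perm \<beta>" "\<alpha> \<noteq> []" "\<beta> \<noteq> []"
  shows "has_increasing 3 (oplus \<alpha> \<beta>) \<longleftrightarrow> has_increasing 2 \<alpha> \<or> has_increasing 2 \<beta>"
proof -
  have le_iff: "i \<le> 3 \<longleftrightarrow> i = 0 \<or> i = 1 \<or> i = 2 \<or> i = 3" for i :: nat
    by linarith
  have *: "(\<exists>i\<le>3. P i (3 - i)) \<longleftrightarrow> P 0 3 \<or> P 1 2 \<or> P 2 1 \<or> P 3 0" for P :: "nat \<Rightarrow> nat \<Rightarrow> bool"
    by (simp add: le_iff conj_disj_distribR ex_disj_distrib)
  show ?thesis
    unfolding has_increasing_oplus_iff[OF assms(1,2)]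
      *[of "\<lambda>i j. has_increasing i \<alpha> \<and> has_increasing j \<beta>"]
    using assms(3,4) has_increasing_le[of 3 \<alpha> 2] has_increasing_le[of 3 \<beta> 2] by auto
qed

text \<open>The splits 1 + 3, 2 + 2 and 3 + 1 decide, since 0 + 4 and 4 + 0 imply the outer
  two.\<close>

lemma has_increasing_4_oplus_iff:
  assumes "is_perm \<alpha>" "is_perm \<beta>" "\<alpha> \<noteq> []" "\<beta> \<noteq> []"
  shows "has_increasing 4 (oplus \<alpha> \<beta>) \<longleftrightarrow>
    has_increasing 3 \<alpha> \<or> has_increasing 3 \<beta> \<or> has_increasing 2 \<alpha> \<and> has_increasing 2 \<beta>"
proof -
  have le_iff: "i \<le> 4 \<longleftrightarrow> i = 0 \<or> i = 1 \<or> i = 2 \<or> i = 3 \<or> i = 4" for i :: nat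
    by linarith
  have *: "(\<exists>i\<le>4. P i (4 - i)) \<longleftrightarrow> P 0 4 \<or> P 1 3 \<or> P 2 2 \<or> P 3 1 \<or> P 4 0"
    for P :: "nat \<Rightarrow> nat \<Rightarrow> bool"
    by (simp add: le_iff conj_disj_distribR ex_disj_distrib)
  show ?thesis
    unfolding has_increasing_oplus_iff[OF assms(1,2)]
      *[of "\<lambda>i j. has_increasing i \<alpha> \<and> has_increasing j \<beta>"]
    using assms(3,4) has_increasing_le[of 4 \<alpha> 3] has_increasing_le[of 4 \<beta> 3] by auto
qed

lemma Ind_subset: "Ind \<sigma> \<subseteq> {\<alpha>. is_perm \<alpha> \<and> indecomposable \<alpha>}"
  by (auto simp: Ind_def Av_def)

lemma not_has_increasing_Nil: "0 < k \<Longrightarrow> \<not> has_increasing k []"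
  by (auto simp: has_increasing_def)

lemma Nil_in_Av_123: "[] \<in> Av [1, 2, 3]"
  unfolding Av_def avoids_123_iff by (simp add: is_perm_iff not_has_increasing_Nil)

lemma Dec_subset: "Dec \<subseteq> Ind [1, 2, 3]"
  using indecomposable_Dec has_increasing_le[of 3 _ 2]
  unfolding Ind_def Av_def avoids_123_iff by (auto simp: Dec_def)

lemma Av_123_decompose:
  "Av [1, 2, 3] = {[]} \<union> (Ind [1, 2, 3] \<union> (\<lambda>(\<alpha>, \<beta>). oplus \<alpha> \<beta>) ` (Dec \<times> Dec))"
proof -
  have "{\<pi>. \<exists>\<alpha> \<beta>. \<pi> = oplus \<alpha> \<beta> \<and> is_perm \<alpha> \<and> indecomposable \<alpha> \<and> is_perm \<beta> \<and> \<beta> \<noteq> [] \<and>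
      avoids \<pi> [1, 2, 3]} = (\<lambda>(\<alpha>, \<beta>). oplus \<alpha> \<beta>) ` (Dec \<times> Dec)" (is "?L = ?R")
  proof
    show "?L \<subseteq> ?R" unfolding avoids_123_iff
      by (force simp: Dec_def has_increasing_3_oplus_iff indecomposable_def)
    show "?R \<subseteq> ?L" unfolding avoids_123_iff
      using indecomposable_Dec by (fastforce simp: Dec_def has_increasing_3_oplus_iff)
  qed
  then show ?thesis
    using Av_decompose[of "[1, 2, 3]"] Nil_in_Av_123 by (auto simp: Av_def Un_assoc)
qed

text \<open>If \<alpha> is decreasing, any nonempty 123-avoider may follow; otherwise \<beta> has to
  be decreasing. Removing \<open>Dec\<close> from the first factor of the second family keeps the
  two families disjoint.\<close>

lemma Av_1234_decompose:
  "Av [1, 2, 3, 4] = {[]} \<union> (Ind [1, 2, 3, 4] \<union>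
     ((\<lambda>(\<alpha>, \<beta>). oplus \<alpha> \<beta>) ` (Dec \<times> (Av [1, 2, 3] - {[]})) \<union>
      (\<lambda>(\<alpha>, \<beta>). oplus \<alpha> \<beta>) ` ((Ind [1, 2, 3] - Dec) \<times> Dec)))"
proof -
  have "{\<pi>. \<exists>\<alpha> \<beta>. \<pi> = oplus \<alpha> \<beta> \<and> is_perm \<alpha> \<and> indecomposable \<alpha> \<and> is_perm \<beta> \<and> \<beta> \<noteq> [] \<and>
      avoids \<pi> [1, 2, 3, 4]} = (\<lambda>(\<alpha>, \<beta>). oplus \<alpha> \<beta>) ` (Dec \<times> (Av [1, 2, 3] - {[]})) \<union>
      (\<lambda>(\<alpha>, \<beta>). oplus \<alpha> \<beta>) ` ((Ind [1, 2, 3] - Dec) \<times> Dec)" (is "?L = ?R")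
  proof
    show "?L \<subseteq> ?R"
    proof
      fix \<pi> assume "\<pi> \<in> ?L"
      then obtain \<alpha> \<beta> where *: "\<pi> = oplus \<alpha> \<beta>" "is_perm \<alpha>" "indecomposable \<alpha>" "is_perm \<beta>" "\<beta> \<noteq> []"
        "\<not> has_increasing 4 \<pi>" unfolding avoids_1234_iff by blast
      moreover from this have "\<alpha> \<noteq> []" by (simp add: indecomposable_def)
      ultimately have "(\<alpha>, \<beta>) \<in> Dec \<times> (Av [1, 2, 3] - {[]}) \<union> (Ind [1, 2, 3] - Dec) \<times> Dec"
        unfolding Av_def Ind_def avoids_123_iff
        by (auto simp: Dec_def has_increasing_4_oplus_iff)
      then show "\<pi> \<in> ?R" using *(1) by force
    qed
    have sub: "Dec \<times> (Av [1, 2, 3] - {[]}) \<union> (Ind [1, 2, 3] - Dec) \<times> Dec \<subseteq>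
      {(\<alpha>, \<beta>). is_perm \<alpha> \<and> indecomposable \<alpha> \<and> is_perm \<beta> \<and> \<beta> \<noteq> [] \<and>
        \<not> has_increasing 4 (oplus \<alpha> \<beta>)}"
      using indecomposable_Dec Dec_subset
      unfolding Av_def Ind_def avoids_123_iff
      by (auto simp: Dec_def has_increasing_4_oplus_iff indecomposable_def)
    show "?R \<subseteq> ?L" unfolding avoids_1234_iff image_Un[symmetric] using sub by fast
  qed
  moreover have "avoids [] [1, 2, 3, 4]"
    unfolding avoids_1234_iff by (simp add: not_has_increasing_Nil)
  ultimately show ?thesis using Av_decompose[of "[1, 2, 3, 4]"] by (simp only: Un_assoc)
qed

lemma oplus_image_subset:
  assumes "S \<subseteq> Collect is_perm" "T \<subseteq> Collect is_perm"
  shows "(\<lambda>(\<alpha>, \<beta>). oplus \<alpha> \<beta>) ` (S \<times> T) \<subseteq> Collect is_perm"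
proof clarify
  fix \<alpha> \<beta> assume "\<alpha> \<in> S" "\<beta> \<in> T"
  then have "is_perm \<alpha>" "is_perm \<beta>" using assms by blast+
  then show "is_perm (oplus \<alpha> \<beta>)" by (simp add: is_perm_oplus_iff)
qed

lemma Nil_not_in_oplus_image:
  assumes "[] \<notin> S \<or> [] \<notin> T"
  shows "[] \<notin> (\<lambda>(\<alpha>, \<beta>). oplus \<alpha> \<beta>) ` (S \<times> T)"
  using assms by (auto simp: oplus_def)

lemma not_indecomposable_oplus_image:
  assumes "S \<subseteq> Collect is_perm" "T \<subseteq> Collect is_perm" "[] \<notin> S" "[] \<notin> T"
    and "\<pi> \<in> (\<lambda>(\<alpha>, \<beta>). oplus \<alpha> \<beta>) ` (S \<times> T)"
  shows "\<not> indecomposable \<pi>"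
proof -
  obtain p where p: "\<pi> = (\<lambda>(\<alpha>, \<beta>). oplus \<alpha> \<beta>) p" "p \<in> S \<times> T" using assms(5) by blast
  obtain \<alpha> \<beta> where "p = (\<alpha>, \<beta>)" by (cases p)
  with p have "\<pi> = oplus \<alpha> \<beta>" "\<alpha> \<in> S" "\<beta> \<in> T" by simp_all
  moreover from this have "is_perm \<alpha>" "is_perm \<beta>" "\<alpha> \<noteq> []" "\<beta> \<noteq> []" using assms(1-4) by blast+
  ultimately show ?thesis by (simp add: not_indecomposable_oplus)
qed

lemma Nil_not_in_Ind: "[] \<notin> Ind \<sigma>"
  by (simp add: Ind_def indecomposable_def)

lemma Nil_not_in_Dec: "[] \<notin> Dec"
  by (simp add: Dec_def)

lemma Dec_perms: "Dec \<subseteq> {\<alpha>. is_perm \<alpha> \<and> indecomposable \<alpha>}"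
  using Ind_subset Dec_subset by blast

lemma descent_gf_Av_123:
  "descent_gf q (Av [1, 2, 3]) = 1 + descent_gf q (Ind [1, 2, 3]) + descent_gf q Dec ^ 2"
proof -
  let ?P = "(\<lambda>(\<alpha>, \<beta>). oplus \<alpha> \<beta>) ` (Dec \<times> Dec)"
  have perm: "Ind \<sigma> \<subseteq> Collect is_perm" "Dec \<subseteq> Collect is_perm" for \<sigma>
    using Ind_subset Dec_perms by blast+
  have P: "?P \<subseteq> Collect is_perm" using perm(2) perm(2) by (rule oplus_image_subset)
  have nil: "{[]} \<subseteq> Collect is_perm" by (simp add: is_perm_iff)
  have ne: "{[]} \<inter> (Ind [1, 2, 3] \<union> ?P) = {}"
    using Nil_not_in_Ind[of "[1, 2, 3]"] Nil_not_in_oplus_image[of Dec Dec] Nil_not_in_Dec by blast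
  have disj: "Ind [1, 2, 3] \<inter> ?P = {}"
    using not_indecomposable_oplus_image[OF perm(2) perm(2) Nil_not_in_Dec Nil_not_in_Dec] Ind_subset
    by blast
  have "descent_gf q (Av [1, 2, 3]) = descent_gf q {[]} + descent_gf q (Ind [1, 2, 3] \<union> ?P)"
    unfolding Av_123_decompose using nil Un_least[OF perm(1) P] ne by (rule descent_gf_Un)
  also have "descent_gf q (Ind [1, 2, 3] \<union> ?P) = descent_gf q (Ind [1, 2, 3]) + descent_gf q ?P"
    using perm(1) P disj by (rule descent_gf_Un)
  finally show ?thesis
    unfolding descent_gf_oplus[OF Dec_perms perm(2)] descent_gf_Nil power2_eq_square add.assoc .
qed

lemma descent_gf_Diff:
  assumes "S \<subseteq> T" "T \<subseteq> Collect is_perm"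
  shows "descent_gf q (T - S) = descent_gf q T - descent_gf q S"
proof -
  have "descent_gf q T = descent_gf q ((T - S) \<union> S)" using assms(1) by (simp add: Un_absorb2)
  also have "\<dots> = descent_gf q (T - S) + descent_gf q S"
    by (rule descent_gf_Un) (use assms in auto)
  finally show ?thesis by simp
qed

lemma descent_gf_Av_1234:
  "descent_gf q (Av [1, 2, 3, 4]) = 1 + descent_gf q (Ind [1, 2, 3, 4])
     + descent_gf q Dec * (descent_gf q (Av [1, 2, 3]) - 1)
     + descent_gf q Dec * (descent_gf q (Ind [1, 2, 3]) - descent_gf q Dec)"
proof -
  let ?f = "\<lambda>(\<alpha>, \<beta>). oplus \<alpha> \<beta>"
  let ?T = "Av [1, 2, 3] - {[]}" and ?J = "Ind [1, 2, 3] - Dec"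
  let ?P = "?f ` (Dec \<times> ?T)" and ?Q = "?f ` (?J \<times> Dec)"
  have perm: "Ind \<sigma> \<subseteq> Collect is_perm" "Av \<sigma> \<subseteq> Collect is_perm" "Dec \<subseteq> Collect is_perm" for \<sigma>
    using Ind_subset Dec_perms unfolding Av_def by blast+
  have J: "?J \<subseteq> {\<alpha>. is_perm \<alpha> \<and> indecomposable \<alpha>}" "?J \<subseteq> Collect is_perm"
    using Ind_subset by blast+
  have T: "?T \<subseteq> Collect is_perm" using perm(2) by blast
  have P: "?P \<subseteq> Collect is_perm" using perm(3) T by (rule oplus_image_subset)
  have Q: "?Q \<subseteq> Collect is_perm" using J(2) perm(3) by (rule oplus_image_subset)
  have nil: "{[]} \<subseteq> Collect is_perm" by (simp add: is_perm_iff)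
  have PQ: "Ind [1, 2, 3, 4] \<union> (?P \<union> ?Q) \<subseteq> Collect is_perm"
    by (intro Un_least perm P Q)
  \<comment> \<open>The families differ in their first component, which the sum determines. The
    second factor \<open>UNIV\<close> places both products in one domain of injectivity.\<close>
  have "?f ` (Dec \<times> UNIV) \<inter> ?f ` (?J \<times> UNIV) = ?f ` (Dec \<times> UNIV \<inter> ?J \<times> UNIV)"
    by (rule inj_on_image_Int[OF inj_on_oplus[of UNIV], symmetric]) (intro Sigma_mono Dec_perms J order_refl)+
  then have disj: "?P \<inter> ?Q = {}" by blast
  have disj': "Ind [1, 2, 3, 4] \<inter> (?P \<union> ?Q) = {}"
  proof -
    have "[] \<notin> ?T" "[] \<notin> ?J" using Nil_not_in_Ind by blast+
    then have "\<not> indecomposable \<pi>" if "\<pi> \<in> ?P \<union> ?Q" for \<pi>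
      using that not_indecomposable_oplus_image[OF perm(3) T Nil_not_in_Dec]
        not_indecomposable_oplus_image[OF J(2) perm(3) _ Nil_not_in_Dec] by blast
    moreover have "indecomposable \<pi>" if "\<pi> \<in> Ind [1, 2, 3, 4]" for \<pi>
      using that Ind_subset by blast
    ultimately show ?thesis by blast
  qed
  have ne: "{[]} \<inter> (Ind [1, 2, 3, 4] \<union> (?P \<union> ?Q)) = {}"
    using Nil_not_in_Ind[of "[1, 2, 3, 4]"] Nil_not_in_oplus_image[of Dec ?T]
      Nil_not_in_oplus_image[of ?J Dec] Nil_not_in_Dec by blast
  have "descent_gf q (Av [1, 2, 3, 4]) = descent_gf q {[]} + descent_gf q (Ind [1, 2, 3, 4] \<union> (?P \<union> ?Q))"
    unfolding Av_1234_decompose using nil PQ ne by (rule descent_gf_Un)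
  also have "descent_gf q (Ind [1, 2, 3, 4] \<union> (?P \<union> ?Q))
      = descent_gf q (Ind [1, 2, 3, 4]) + descent_gf q (?P \<union> ?Q)"
    using perm(1) Un_least[OF P Q] disj' by (rule descent_gf_Un)
  also have "descent_gf q (?P \<union> ?Q) = descent_gf q ?P + descent_gf q ?Q"
    using P Q disj by (rule descent_gf_Un)
  also have "descent_gf q ?P = descent_gf q Dec * (descent_gf q (Av [1, 2, 3]) - descent_gf q {[]})"
    unfolding descent_gf_oplus[OF Dec_perms T]
    by (subst descent_gf_Diff) (use Nil_in_Av_123 perm(2) in \<open>simp_all del: One_nat_def\<close>)
  also have "descent_gf q ?Q = (descent_gf q (Ind [1, 2, 3]) - descent_gf q Dec) * descent_gf q Dec"
    unfolding descent_gf_oplus[OF J(1) perm(3)] descent_gf_Diff[OF Dec_subset perm(1)] ..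
  finally show ?thesis unfolding descent_gf_Nil by (simp only: add.assoc mult.commute)
qed

section \<open>The series of the statement as descent generating functions\<close>

lemma Av_length: "{\<pi> \<in> Av \<sigma>. length \<pi> = n} = avoiding_perms \<sigma> n"
  unfolding Av_def avoiding_perms_def permutations_of_set_iff by blast

lemma Ind_length: "{\<pi> \<in> Ind \<sigma>. length \<pi> = n} = avoiding_indec_perms \<sigma> n"
  unfolding Ind_def avoiding_indec_perms_def Av_length[symmetric] by blast

text \<open>Links the sums over permutations in \<open>descent_gf\<close> to the counts
  \<open>A_coeff\<close> and \<open>I_coeff\<close>.\<close>

lemma fps_nth_sum_X_power:
  assumes "finite S"
  shows "fps_nth (\<Sum>\<pi>\<in>S. fps_X ^ f \<pi>) i = (of_nat (card {\<pi> \<in> S. f \<pi> = i}) :: 'a::comm_ring_1)"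
proof -
  have "fps_nth (\<Sum>\<pi>\<in>S. fps_X ^ f \<pi>) i = (\<Sum>\<pi>\<in>S. if f \<pi> = i then 1 else 0 :: 'a)"
    unfolding fps_sum_nth by (intro sum.cong) auto
  then show ?thesis using assms by (simp add: sum.If_cases Int_def)
qed

lemma avoiding_perms_0:
  assumes "avoids [] \<sigma>"
  shows "avoiding_perms \<sigma> 0 = {[]}"
  using assms by (auto simp: avoiding_perms_def)

lemma finite_avoiding_perms [simp]: "finite (avoiding_perms \<sigma> n)"
  by (simp add: avoiding_perms_def)

lemma avoiding_indec_perms_0: "avoiding_indec_perms \<sigma> 0 = {}"
  by (auto simp: avoiding_indec_perms_def avoiding_perms_def indecomposable_def)

text \<open>Taking \<open>fps_X\<close> for q yields the bivariate series, and q = 1 below yields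
  plain counting. The separate summand 1 in \<open>A_series2\<close> is the empty permutation, which
  avoids \<sigma> by assumption.\<close>

lemma A_series2_eq:
  assumes "avoids [] \<sigma>"
  shows "A_series2 \<sigma> = descent_gf fps_X (Av \<sigma>)"
proof (rule fps_ext)+
  fix n i
  show "fps_nth (fps_nth (A_series2 \<sigma>) n) i = fps_nth (fps_nth (descent_gf fps_X (Av \<sigma>)) n) i"
  proof (cases "n = 0")
    case True
    then show ?thesis
      unfolding descent_gf_def fps_nth_Abs_fps Av_length
      using avoiding_perms_0[OF assms] by (simp add: A_series2_def descents_def)
  qed (simp add: descent_gf_def Av_length A_series2_def fps_nth_sum_X_power A_coeff_def)
qed

lemma I_series2_eq: "I_series2 \<sigma> = descent_gf fps_X (Ind \<sigma>)"
proof (rule fps_ext)+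
  fix n i
  show "fps_nth (fps_nth (I_series2 \<sigma>) n) i = fps_nth (fps_nth (descent_gf fps_X (Ind \<sigma>)) n) i"
    unfolding descent_gf_def fps_nth_Abs_fps Ind_length
    by (auto simp: I_series2_def fps_nth_sum_X_power I_coeff_def avoiding_indec_perms_0
        finite_avoiding_indec_perms)
qed

lemma E_series_eq: "E_series = descent_gf 1 (Av [1, 2, 3, 4])"
  unfolding E_series_def descent_gf_def Av_length by (simp add: E_num_def)

lemma I_series_eq: "I_series \<sigma> = descent_gf 1 (Ind \<sigma>)"
  unfolding I_series_def descent_gf_def Ind_length
  by (auto simp: fps_eq_iff I_num_def avoiding_indec_perms_0)

lemma catalan_series_eq: "catalan_series = descent_gf 1 (Av [1, 2, 3])"
  unfolding catalan_series_def descent_gf_def Av_length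
  by (simp add: fps_eq_iff card_avoiding_perms_123 del: One_nat_def)

section \<open>Partial sums and the explicit formula for the coefficients\<close>

lemma fps_nth_geometric_mult:
  fixes D F :: "real fps"
  assumes "(1 - fps_X) * D = fps_X"
  shows "fps_nth (D * F) n = (\<Sum>i<n. fps_nth F i)"
proof (induction n)
  case 0
  have "fps_nth ((1 - fps_X) * D) 0 = 0" unfolding assms by simp
  then show ?case by simp
next
  case (Suc n)
  \<comment> \<open>Multiplying by 1 - x takes differences of consecutive coefficients, so those of
    \<open>D * F\<close> grow by the coefficients of \<open>F\<close>.\<close>
  have "(1 - fps_X) * D * F = fps_X * F" by (simp only: assms)
  moreover have "(1 - fps_X) * D * F = D * F - fps_X * (D * F)" by (simp add: algebra_simps)
  ultimately have "fps_nth (D * F - fps_X * (D * F)) (Suc n) = fps_nth (fps_X * F) (Suc n)"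
    by (simp only:)
  then have "fps_nth (D * F) (Suc n) - fps_nth (D * F) n = fps_nth F n" by simp
  then show ?case using Suc by simp
qed

theorem theorem3p19:
  shows "A_series2 [1, 2, 3, 4] =
           1 + I_series2 [1, 2, 3, 4]
           + var_x / (1 - var_x * var_q) * (A_series2 [1, 2, 3] - 1)
           + var_x / (1 - var_x * var_q) * (I_series2 [1, 2, 3] - var_x / (1 - var_x * var_q))
       \<and> I_series [1, 2, 3, 4] =
           E_series - 2 * fps_X / (1 - fps_X) * catalan_series
           + fps_X ^ 3 / (1 - fps_X) ^ 3 + fps_X ^ 2 / (1 - fps_X) ^ 2
           + 2 * fps_X / (1 - fps_X) - 1
       \<and> I_num [1, 2, 3, 4] 1 = 1
       \<and> (\<forall>n\<ge>2. real (I_num [1, 2, 3, 4] n) =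
           real (E_num n) - 2 * (\<Sum>i = 0..n - 1. catalan i)
           + 1 / 2 * (real n ^ 2 - real n + 4))
       \<and> catalan_series =
           (1 - fps_radical (\<lambda>k. root k) 2 (1 - 4 * fps_X)) / (2 * fps_X)
       \<and> E_num 0 = 1"
proof (intro conjI allI impI)
  have av: "avoids [] [1, 2, 3]" "avoids [] [1, 2, 3, 4]"
    unfolding avoids_123_iff avoids_1234_iff by (simp_all add: not_has_increasing_Nil)
  \<comment> \<open>The coefficient ring is no field, so the quotient is identified with the series
    of \<open>Dec\<close> by cancelling the nonzero factor 1 - x q.\<close>
  have "(1 - var_x * var_q) * (var_x / (1 - var_x * var_q))
      = (1 - var_x * var_q) * descent_gf fps_X Dec"
    unfolding divide_one_minus_xq by (simp add: var_x_def var_q_def descent_gf_Dec)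
  moreover have "1 - var_x * var_q \<noteq> 0"
  proof
    assume "1 - var_x * var_q = 0"
    then have "fps_nth (1 - var_x * var_q) 0 = 0" by simp
    then show False by (simp add: var_x_def)
  qed
  ultimately have "var_x / (1 - var_x * var_q) = descent_gf fps_X Dec" by simp
  then show "A_series2 [1, 2, 3, 4] =
      1 + I_series2 [1, 2, 3, 4]
      + var_x / (1 - var_x * var_q) * (A_series2 [1, 2, 3] - 1)
      + var_x / (1 - var_x * var_q) * (I_series2 [1, 2, 3] - var_x / (1 - var_x * var_q))"
    unfolding A_series2_eq[OF av(1)] A_series2_eq[OF av(2)] I_series2_eq
    by (simp only: descent_gf_Av_1234)

  define D :: "real fps" where "D = descent_gf 1 Dec"
  have D: "(1 - fps_X) * D = fps_X" using descent_gf_Dec[of "1 :: real"] by (simp add: D_def)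
  have ne: "(1 - fps_X :: real fps) \<noteq> 0"
  proof
    assume "(1 - fps_X :: real fps) = 0"
    then have "fps_nth (1 - fps_X :: real fps) 0 = 0" by simp
    then show False by simp
  qed
  have pow: "fps_X ^ k / (1 - fps_X) ^ k = D ^ k" for k
  proof -
    have "((1 - fps_X) * D) ^ k = fps_X ^ k" by (simp only: D)
    then have "fps_X ^ k = D ^ k * (1 - fps_X) ^ k"
      by (simp only: power_mult_distrib mult.commute)
    then show ?thesis using ne by simp
  qed
  have two: "2 * fps_X / (1 - fps_X) = 2 * D"
  proof -
    have "2 * fps_X = 2 * ((1 - fps_X) * D)" by (simp only: D)
    also have "\<dots> = (2 * D) * (1 - fps_X)" by (simp only: mult_ac)
    finally show ?thesis by (simp only: nonzero_mult_div_cancel_right[OF ne])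
  qed
  \<comment> \<open>Both sides are expanded in \<open>D\<close> and the series of indecomposable
    avoiders; the indecomposable 123-avoiders cancel.\<close>
  have I: "I_series [1, 2, 3, 4] =
      E_series - 2 * D * catalan_series + D ^ 3 + D ^ 2 + 2 * D - 1"
    unfolding E_series_eq I_series_eq catalan_series_eq descent_gf_Av_1234 descent_gf_Av_123
    by (simp add: D_def[symmetric] power2_eq_square power3_eq_cube algebra_simps)
  then show "I_series [1, 2, 3, 4] =
      E_series - 2 * fps_X / (1 - fps_X) * catalan_series
      + fps_X ^ 3 / (1 - fps_X) ^ 3 + fps_X ^ 2 / (1 - fps_X) ^ 2
      + 2 * fps_X / (1 - fps_X) - 1"
    unfolding pow two .

  show E0: "E_num 0 = 1" unfolding E_num_def avoiding_perms_0[OF av(2)] by simp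
  have nth: "fps_nth (D * F) n = (\<Sum>i<n. fps_nth F i)" for F n
    using D by (rule fps_nth_geometric_mult)
  have D1: "fps_nth D n = (if n = 0 then 0 else 1)" for n
    using nth[of 1 n] by (simp add: sum.delta' lessThan_Suc)
  \<comment> \<open>Iterated partial sums give n - 1 here and the binomial (n - 1 choose 2) below.
    Both need \<open>1 \<le> n\<close>: at 0 the coefficients vanish, while the polynomials give -1
    and 1.\<close>
  have D2: "fps_nth (D * D) n = real n - 1" if "1 \<le> n" for n
    using that by (induction n rule: dec_induct) (auto simp: nth D1)
  have D3: "fps_nth (D * (D * D)) n = (real n - 1) * (real n - 2) / 2" if "1 \<le> n" for n
    using that
  proof (induction n rule: dec_induct)
    case (step n)
    then show ?case using D2[of n] unfolding nth[of "D * D"] by (simp add: field_simps)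
  qed (simp add: nth D1)
  have C: "fps_nth (D * catalan_series) n = (\<Sum>i<n. catalan i)" for n
    unfolding nth by (simp add: catalan_series_def)
  \<comment> \<open>The formula already holds from n = 1 on, so it also supplies the separate value
    at 1.\<close>
  have key: "real (I_num [1, 2, 3, 4] n) = real (E_num n) - 2 * (\<Sum>i = 0..n - 1. catalan i)
      + 1 / 2 * (real n ^ 2 - real n + 4)" if n: "1 \<le> n" for n
  proof -
    have "real (I_num [1, 2, 3, 4] n) = fps_nth (I_series [1, 2, 3, 4]) n"
      using n by (simp add: I_series_def)
    also have "I_series [1, 2, 3, 4] = E_series - fps_const 2 * (D * catalan_series) + D * (D * D) + D * D
        + fps_const 2 * D - 1"
      unfolding I by (simp add: power2_eq_square power3_eq_cube mult.assoc numeral_fps_const)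
    also have "fps_nth \<dots> n = real (E_num n) - 2 * (\<Sum>i<n. catalan i)
        + (real n - 1) * (real n - 2) / 2 + (real n - 1) + 2"
      using n by (simp add: D1 D2 D3 C E_series_def)
    also have "{..<n} = {0..n - 1}" using n by auto
    finally show ?thesis by (simp add: field_simps power2_eq_square)
  qed
  then show "real (I_num [1, 2, 3, 4] n) = real (E_num n) - 2 * (\<Sum>i = 0..n - 1. catalan i)
      + 1 / 2 * (real n ^ 2 - real n + 4)" if "2 \<le> n" for n
    using that by simp
  have "real (E_num 1) = 1"
  proof -
    have "avoiding_perms [1, 2, 3, 4] 1 = {[1]}"
    proof -
      have "avoids [1] [1, 2, 3, 4]"
        unfolding avoids_1234_iff by (auto simp: has_increasing_def dest: list_emb_length)
      then show ?thesis by (auto simp: avoiding_perms_def permutations_of_set_singleton)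
    qed
    then show ?thesis by (simp add: E_num_def)
  qed
  \<comment> \<open>At n = 1 the formula reads 1 - 2 + 2.\<close>
  then have "real (I_num [1, 2, 3, 4] 1) = 1" using key[of 1] by (simp add: catalan_def)
  then show "I_num [1, 2, 3, 4] 1 = 1" by linarith
  show "catalan_series = (1 - fps_radical (\<lambda>k. root k) 2 (1 - 4 * fps_X)) / (2 * fps_X)"
    by (rule catalan_series_radical)
qed

end
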